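(* Let $E=\mathbb{R}$ or $E=\mathbb{R}^2$ and let $\{X_i(t)\}_{t\in E}$, $i=1,2,\dots$, be i.i.d. stochastic processes with continuous sample paths. Suppose that there are continuous functions $a_n>0$ and $b_n$ on $E$ such that, as $n\to\infty$, $$\left\{\frac{\max_{1\le i\le n}X_i(t)-b_n(t)}{a_n(t)}\right\}_{t\in E}\to\{\tilde Z(t)\}_{t\in E}\quad\text{weakly in }C(E),$$ where the limit is standardized so that $P\{\tilde Z(t)\le x\}=\exp\{-(1+\gamma(t)x)^{-1/\gamma(t)}\}$ for $1+\gamma(t)x>0$ with $\gamma$ continuous, and where $Z(t):=(1+\gamma(t)\tilde Z(t))_+^{1/\gamma(t)}$ is, in law, the moving maximum process with parameter $\beta>0$ of one of the following models: for $E=\mathbb{R}$, the exponential, normal or $t$-model; for $E=\mathbb{R}^2$, the exponential, normal or $t$-model. Let $t_1,\dots,t_d\in E$ ($d\ge2$) be distinct, and let $k=k(n)$ satisfy $k(n)\to\infty$ and $k(n)/n\to0$ as $n\to\infty$. Then, as $n\to\infty$: (a) if $E=\mathbb{R}$ (any of the three models), $\hat\beta^{(1)}\to\beta$ and $\hat\beta_1\to\beta$ in probability; (b) if $E=\mathbb{R}^2$ and the model is the normal or the $t$-model, $\hat\beta_2\to\beta$ in probability; (c) if $E=\mathbb{R}^2$ and the model is the exponential model, $\hat\beta_{e,2}\to\beta$ in probability.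
   Context: Models. The moving maximum process generated by a probability density $\phi$ on $E$ is the process with finite-dimensional distributions $P\{Z(t_1)\le x_1,\dots,Z(t_d)\le x_d\}=\exp\{-\int_E\max_{i}\phi(s-t_i)/x_i\,ds\}$ ($x_i>0$). For $E=\mathbb{R}$: $\phi(x)=\beta\varphi_0(\beta x)$ with $\varphi_0(x)=\frac12e^{-|x|}$ (exponential model), $\varphi_0(x)=\frac1{\sqrt{2\pi}}e^{-x^2/2}$ (normal model), or $\varphi_0(x)=\frac{\Gamma((\nu+1)/2)}{\sqrt{\pi\nu}\Gamma(\nu/2)}(1+x^2/\nu)^{-(\nu+1)/2}$ with $\nu$ a (known) positive integer ($t$-model). For $E=\mathbb{R}^2$: $\phi(\mathbf{u})=\beta^2\varphi_0(\beta\mathbf{u})$ with $\varphi_0(u_1,u_2)=\frac14e^{-|u_1|-|u_2|}$ (exponential model), $\varphi_0(\mathbf{u})=\frac1{2\pi}e^{-|\mathbf{u}|^2/2}$ (normal model), or $\varphi_0(\mathbf{u})=\frac1{2\pi}\{1+\frac{|\mathbf{u}|^2}{2(\alpha-1)}\}^{-\alpha}$ with $\alpha>1$ known ($t$-model), $|\cdot|$ the Euclidean norm. $F$ denotes the distribution function of $\varphi_0$ if $E=\mathbb{R}$; for $E=\mathbb{R}^2$ and the normal or $t$-model, $F$ is the common one-dimensional marginal distribution function of $\varphi_0$. $F^{\leftarrow}$ is the inverse of $F$. For sites $s_1,\dots,s_m\in E$, $$\hat R_{s_1,\dots,s_m}(1,\dots,1):=\frac1k\sum_{i=1}^nI_{\{X_i(s_1)\ge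 X_{n-k+1,n}(s_1),\dots,X_i(s_m)\ge X_{n-k+1,n}(s_m)\}},$$ where $X_{1,n}(s)\le\dots\le X_{n,n}(s)$ are the order statistics of $X_1(s),\dots,X_n(s)$ ($k$ is taken to be a positive integer, $k<n$). Estimators: $$\hat\beta^{(1)}:=\frac{2F^{\leftarrow}(1-\hat R_{t_1,\dots,t_d}(1,\dots,1)/2)}{\max_jt_j-\min_jt_j},\qquad \hat\beta_1:=\frac2{d(d-1)}\sum_{1\le j<m\le d}\frac2{|t_j-t_m|}F^{\leftarrow}(1-\hat R_{t_j,t_m}(1,1)/2)\quad(E=\mathbb{R}),$$ $$\hat\beta_2:=\frac2{d(d-1)}\sum_{1\le j<m\le d}\frac2{|t_j-t_m|}F^{\leftarrow}(1-\hat R_{t_j,t_m}(1,1)/2)\quad(E=\mathbb{R}^2),$$ $$\hat\beta_{e,2}:=\frac2{d(d-1)}\sum_{1\le j<m\le d}Q_{a_{j,m},b_{j,m}}(\hat R_{t_j,t_m}(1,1))\quad(E=\mathbb{R}^2),$$ where $a_{j,m}$ and $b_{j,m}$ are the absolute differences of the first, respectively second, coordinates of $t_j$ and $t_m$, and $Q_{a,b}$ is the inverse function of the decreasing function $\beta\mapsto(1+\frac\beta2\min(a,b))\exp\{-\frac\beta2(a+b)\}$, $\beta>0$. (Where $F^{\leftarrow}$ or $Q_{a,b}$ has an argument outside its domain, any fixed finite value may be used.) $C(E)$ carries the topology of locally uniform convergence. *)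

theory Defs
  imports "HOL-Probability.Probability"
begin

section \<open>Weak convergence in the space of continuous functions\<close>

text \<open>The space of continuous functions with the topology of locally uniform convergence,
  i.e. uniform convergence on compact sets.\<close>

definition C_nbhd :: "('e::topological_space \<Rightarrow> real) \<Rightarrow> 'e set \<Rightarrow> real \<Rightarrow> ('e \<Rightarrow> real) set" where
  "C_nbhd f K \<epsilon> = {g. continuous_on UNIV g \<and> (\<forall>x\<in>K. \<bar>g x - f x\<bar> < \<epsilon>)}"

definition C_open :: "('e::topological_space \<Rightarrow> real) set \<Rightarrow> bool" where
  "C_open U \<longleftrightarrow> U \<subseteq> {f. continuous_on UNIV f} \<and>
     (\<forall>f\<in>U. \<exists>K \<epsilon>. compact K \<and> \<epsilon> > 0 \<and> C_nbhd f K \<epsilon> \<subseteq> U)"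

lemma istopology_C_open: "istopology (C_open :: ('e::topological_space \<Rightarrow> real) set \<Rightarrow> bool)"
  unfolding istopology_def
proof (intro conjI allI impI)
  fix S T :: "('e \<Rightarrow> real) set"
  assume S: "C_open S" and T: "C_open T"
  have "\<exists>K \<epsilon>. compact K \<and> \<epsilon> > 0 \<and> C_nbhd f K \<epsilon> \<subseteq> S \<inter> T" if f: "f \<in> S" "f \<in> T" for f
  proof -
    obtain K \<epsilon> where K: "compact K" "\<epsilon> > 0" "C_nbhd f K \<epsilon> \<subseteq> S"
      using S f(1) unfolding C_open_def by blast
    obtain L \<delta> where L: "compact L" "\<delta> > 0" "C_nbhd f L \<delta> \<subseteq> T"
      using T f(2) unfolding C_open_def by blast
    have "C_nbhd f (K \<union> L) (min \<epsilon> \<delta>) \<subseteq> C_nbhd f K \<epsilon> \<inter> C_nbhd f L \<delta>"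
      by (simp add: C_nbhd_def subset_iff)
    then have "C_nbhd f (K \<union> L) (min \<epsilon> \<delta>) \<subseteq> S \<inter> T"
      using K(3) L(3) by blast
    moreover have "compact (K \<union> L)" "min \<epsilon> \<delta> > 0"
      using K L by (simp_all add: compact_Un)
    ultimately show ?thesis by blast
  qed
  then show "C_open (S \<inter> T)"
    using S unfolding C_open_def by blast
next
  fix \<U> :: "('e \<Rightarrow> real) set set"
  assume \<U>: "\<forall>U\<in>\<U>. C_open U"
  have "\<exists>K \<epsilon>. compact K \<and> \<epsilon> > 0 \<and> C_nbhd f K \<epsilon> \<subseteq> \<Union>\<U>" if U: "U \<in> \<U>" "f \<in> U" for f U
  proof -
    have "C_open U" using \<U> U(1) by blast
    then obtain K \<epsilon> where K: "compact K" "\<epsilon> > 0" "C_nbhd f K \<epsilon> \<subseteq> U"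
      using U(2) unfolding C_open_def by blast
    have "C_nbhd f K \<epsilon> \<subseteq> \<Union>\<U>"
      using K(3) Union_upper[OF U(1)] by (rule subset_trans)
    with K(1,2) show ?thesis by blast
  qed
  moreover have "\<Union>\<U> \<subseteq> {f. continuous_on UNIV f}"
    using \<U> by (intro Union_least) (simp add: C_open_def)
  ultimately show "C_open (\<Union>\<U>)"
    unfolding C_open_def by (metis UnionE)
qed

definition C_top :: "('e::topological_space \<Rightarrow> real) topology" where
  "C_top = topology C_open"

lemma openin_C_top: "openin C_top U \<longleftrightarrow> C_open U"
  unfolding C_top_def by (simp add: istopology_C_open)

lemma topspace_C_top:
  "topspace C_top = {f :: 'e::topological_space \<Rightarrow> real. continuous_on UNIV f}"
proof (rule antisym)
  have "C_open (topspace (C_top :: ('e \<Rightarrow> real) topology))"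
    unfolding openin_C_top[symmetric] by (rule openin_topspace)
  then show "topspace C_top \<subseteq> {f :: 'e \<Rightarrow> real. continuous_on UNIV f}"
    unfolding C_open_def by (rule conjunct1)
  have "compact {} \<and> (1 :: real) > 0 \<and> C_nbhd f {} 1 \<subseteq> {f. continuous_on UNIV f}"
    for f :: "'e \<Rightarrow> real"
    by (simp add: C_nbhd_def)
  then have "C_open {f :: 'e \<Rightarrow> real. continuous_on UNIV f}"
    unfolding C_open_def by (metis order_refl)
  then show "{f :: 'e \<Rightarrow> real. continuous_on UNIV f} \<subseteq> topspace C_top"
    unfolding openin_C_top[symmetric] by (rule openin_subset)
qed

text \<open>Weak convergence of processes with continuous paths, through bounded continuous
  functionals. The processes \<open>Y n\<close> live on \<open>M\<close>, the limit on its own space \<open>N\<close>. For a process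
  with continuous paths and measurable coordinates the integrands are measurable, because the
  Borel sets of the space of continuous functions are generated by the evaluations.\<close>

definition weak_conv_C ::
    "'w measure \<Rightarrow> (nat \<Rightarrow> 'w \<Rightarrow> 'e::topological_space \<Rightarrow> real) \<Rightarrow> 'v measure \<Rightarrow> ('v \<Rightarrow> 'e \<Rightarrow> real) \<Rightarrow> bool"
  where
  "weak_conv_C M Y N Z \<longleftrightarrow>
     (\<forall>H. continuous_map C_top euclideanreal H \<and> bounded (H ` topspace C_top) \<longrightarrow>
        (\<lambda>n. \<integral>\<omega>. H (Y n \<omega>) \<partial>M) \<longlonglongrightarrow> (\<integral>\<omega>. H (Z \<omega>) \<partial>N))"

definition conv_in_prob :: "'w measure \<Rightarrow> (nat \<Rightarrow> 'w \<Rightarrow> real) \<Rightarrow> real \<Rightarrow> bool" where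
  "conv_in_prob M Y y \<longleftrightarrow> (\<forall>n. Y n \<in> borel_measurable M) \<and>
     (\<forall>\<epsilon>>0. (\<lambda>n. measure M {\<omega>\<in>space M. \<bar>Y n \<omega> - y\<bar> > \<epsilon>}) \<longlonglongrightarrow> 0)"

section \<open>Max-stable limits and moving maximum processes\<close>

definition moving_maximum ::
    "'v measure \<Rightarrow> ('v \<Rightarrow> 'e::euclidean_space \<Rightarrow> real) \<Rightarrow> ('e \<Rightarrow> real) \<Rightarrow> bool" where
  "moving_maximum N Z \<phi> \<longleftrightarrow>
     (\<forall>d\<ge>1. \<forall>(t :: nat \<Rightarrow> 'e) (x :: nat \<Rightarrow> real). (\<forall>i\<in>{1..d}. x i > 0) \<longrightarrow>
        measure N {\<omega>\<in>space N. \<forall>i\<in>{1..d}. Z \<omega> (t i) \<le> x i}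
          = exp (- (\<integral>s. (MAX i\<in>{1..d}. \<phi> (s - t i) / x i) \<partial>lborel)))"

text \<open>For \<open>g = 0\<close> the expressions \<open>(1 + g * x) powr (-1 / g)\<close> and \<open>(1 + g * x) powr (1 / g)\<close> are
  read, as usual for extreme value distributions, as their limits \<open>exp (- x)\<close> and \<open>exp x\<close>.
  For \<open>g < 0\<close> the event \<open>1 + g * x \<le> 0\<close>, where \<open>0 powr (1 / g) = 0\<close> is a junk value, has
  probability zero in \<open>gev_cdf\<close>, so that finite-dimensional distributions do not see it.\<close>

definition gev_cdf :: "real \<Rightarrow> real \<Rightarrow> real" where
  "gev_cdf g x = exp (- (if g = 0 then exp (- x) else (1 + g * x) powr (- 1 / g)))"

definition gev_to_frechet :: "real \<Rightarrow> real \<Rightarrow> real" where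
  "gev_to_frechet g x = (if g = 0 then exp x else (max 0 (1 + g * x)) powr (1 / g))"

text \<open>The i.i.d. processes are \<open>X 1, X 2, \<dots>\<close> (the index 0 is not used), independent and equal in
  law with respect to the product sigma-algebra. \<open>Zt\<close> is the standardized limit
  and \<open>\<phi>\<close> the density generating the moving maximum process in its law.\<close>

locale max_attraction = prob_space M + limit: prob_space N
  for M :: "'w measure" and N :: "'v measure" +
  fixes X :: "nat \<Rightarrow> 'w \<Rightarrow> 'e::euclidean_space \<Rightarrow> real"
    and a b :: "nat \<Rightarrow> 'e \<Rightarrow> real"
    and Zt :: "'v \<Rightarrow> 'e \<Rightarrow> real"
    and \<gamma> :: "'e \<Rightarrow> real"
    and \<phi> :: "'e \<Rightarrow> real"
  assumes indep_X: "indep_vars (\<lambda>_. \<Pi>\<^sub>M t\<in>UNIV. borel) X {1..}"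
    and ident_X: "\<And>i. i \<ge> 1 \<Longrightarrow>
      distr M (\<Pi>\<^sub>M t\<in>UNIV. borel) (X i) = distr M (\<Pi>\<^sub>M t\<in>UNIV. borel) (X 1)"
    and cont_X: "\<And>i \<omega>. i \<ge> 1 \<Longrightarrow> \<omega> \<in> space M \<Longrightarrow> continuous_on UNIV (X i \<omega>)"
    and cont_a: "\<And>n. n \<ge> 1 \<Longrightarrow> continuous_on UNIV (a n)"
    and a_pos: "\<And>n t. n \<ge> 1 \<Longrightarrow> a n t > 0"
    and cont_b: "\<And>n. n \<ge> 1 \<Longrightarrow> continuous_on UNIV (b n)"
    and measurable_Zt: "Zt \<in> N \<rightarrow>\<^sub>M (\<Pi>\<^sub>M t\<in>UNIV. borel)"
    and cont_Zt: "\<And>\<omega>. \<omega> \<in> space N \<Longrightarrow> continuous_on UNIV (Zt \<omega>)"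
    and weak_limit:
      "weak_conv_C M (\<lambda>n \<omega> t. ((MAX i\<in>{1..n}. X i \<omega> t) - b n t) / a n t) N Zt"
    and cont_\<gamma>: "continuous_on UNIV \<gamma>"
    and marginal_Zt: "\<And>t x. 1 + \<gamma> t * x > 0 \<Longrightarrow>
      measure N {\<omega>\<in>space N. Zt \<omega> t \<le> x} = gev_cdf (\<gamma> t) x"
    and moving_maximum_Z: "moving_maximum N (\<lambda>\<omega> t. gev_to_frechet (\<gamma> t) (Zt \<omega> t)) \<phi>"

section \<open>The models\<close>

text \<open>The parameter of the \<open>t\<close>-model is the number of degrees of freedom \<open>\<nu>\<close> (a positive natural
  number) on the line and the exponent \<open>\<alpha> > 1\<close> in the plane.\<close>

datatype 'p model = Exponential | Normal | Student_t 'p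

fun \<phi>0_line :: "nat model \<Rightarrow> real \<Rightarrow> real" where
  "\<phi>0_line Exponential x = exp (- \<bar>x\<bar>) / 2"
| "\<phi>0_line Normal x = exp (- x\<^sup>2 / 2) / sqrt (2 * pi)"
| "\<phi>0_line (Student_t \<nu>) x =
     Gamma ((real \<nu> + 1) / 2) / (sqrt (pi * real \<nu>) * Gamma (real \<nu> / 2)) *
     (1 + x\<^sup>2 / real \<nu>) powr (- (real \<nu> + 1) / 2)"

text \<open>The norm of \<^typ>\<open>real \<times> real\<close> is the Euclidean norm.\<close>

fun \<phi>0_plane :: "real model \<Rightarrow> real \<times> real \<Rightarrow> real" where
  "\<phi>0_plane Exponential u = exp (- \<bar>fst u\<bar> - \<bar>snd u\<bar>) / 4"
| "\<phi>0_plane Normal u = exp (- (norm u)\<^sup>2 / 2) / (2 * pi)"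
| "\<phi>0_plane (Student_t \<alpha>) u = (1 + (norm u)\<^sup>2 / (2 * (\<alpha> - 1))) powr (- \<alpha>) / (2 * pi)"

definition F_line :: "nat model \<Rightarrow> real \<Rightarrow> real" where
  "F_line m = cdf (density lborel (\<lambda>x. ennreal (\<phi>0_line m x)))"

text \<open>The two one-dimensional marginals coincide; the first one is used.\<close>

definition F_plane :: "real model \<Rightarrow> real \<Rightarrow> real" where
  "F_plane m = cdf (distr (density lborel (\<lambda>u. ennreal (\<phi>0_plane m u))) borel fst)"

section \<open>The estimators\<close>

text \<open>The inverse of the restriction of \<open>f\<close> to \<open>D\<close>, with the value \<open>c\<close> outside \<open>f ` D\<close>.\<close>

definition inverse_fun :: "real set \<Rightarrow> (real \<Rightarrow> real) \<Rightarrow> real \<Rightarrow> real \<Rightarrow> real" where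
  "inverse_fun D f c p = (if p \<in> f ` D then inv_into D f p else c)"

text \<open>\<open>order_stat x j n\<close> is the \<open>j\<close>-th smallest of \<open>x 1, \<dots>, x n\<close>, for \<open>1 \<le> j \<le> n\<close>.\<close>

definition order_stat :: "(nat \<Rightarrow> real) \<Rightarrow> nat \<Rightarrow> nat \<Rightarrow> real" where
  "order_stat x j n = sort (map x [1..<Suc n]) ! (j - 1)"

text \<open>\<open>R_hat X n k S\<close> depends on the sites only through the set \<open>S\<close> of them.\<close>

definition R_hat :: "(nat \<Rightarrow> 'w \<Rightarrow> 'e \<Rightarrow> real) \<Rightarrow> nat \<Rightarrow> nat \<Rightarrow> 'e set \<Rightarrow> 'w \<Rightarrow> real" where
  "R_hat X n k S \<omega> = 1 / real k *
     (\<Sum>i=1..n. of_bool (\<forall>s\<in>S. X i \<omega> s \<ge> order_stat (\<lambda>l. X l \<omega> s) (n - k + 1) n))"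

text \<open>In the following estimators \<open>R\<close> is the map \<open>S \<mapsto> R_hat X n k S \<omega>\<close>, \<open>F\<close> is the distribution
  function to be inverted and \<open>c\<close> is the value used outside the domain of the inverse.\<close>

definition \<beta>_range :: "(real \<Rightarrow> real) \<Rightarrow> real \<Rightarrow> nat \<Rightarrow> (nat \<Rightarrow> real) \<Rightarrow> (real set \<Rightarrow> real) \<Rightarrow> real" where
  "\<beta>_range F c d t R =
     2 * inverse_fun UNIV F c (1 - R (t ` {1..d}) / 2) /
       ((MAX j\<in>{1..d}. t j) - (MIN j\<in>{1..d}. t j))"

definition \<beta>_pairs ::
    "(real \<Rightarrow> real) \<Rightarrow> real \<Rightarrow> nat \<Rightarrow> (nat \<Rightarrow> 'e::real_normed_vector) \<Rightarrow> ('e set \<Rightarrow> real) \<Rightarrow> real" where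
  "\<beta>_pairs F c d t R = 2 / (real d * (real d - 1)) *
     (\<Sum>m=1..d. \<Sum>j=1..<m.
        2 / norm (t j - t m) * inverse_fun UNIV F c (1 - R {t j, t m} / 2))"

definition Q :: "real \<Rightarrow> real \<Rightarrow> real \<Rightarrow> real \<Rightarrow> real" where
  "Q c a b = inverse_fun {0<..} (\<lambda>\<beta>. (1 + \<beta> / 2 * min a b) * exp (- \<beta> / 2 * (a + b))) c"

definition \<beta>_exp_plane ::
    "real \<Rightarrow> nat \<Rightarrow> (nat \<Rightarrow> real \<times> real) \<Rightarrow> ((real \<times> real) set \<Rightarrow> real) \<Rightarrow> real" where
  "\<beta>_exp_plane c d t R = 2 / (real d * (real d - 1)) *
     (\<Sum>m=1..d. \<Sum>j=1..<m.
        Q c \<bar>fst (t j) - fst (t m)\<bar> \<bar>snd (t j) - snd (t m)\<bar> (R {t j, t m}))"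

end

theory Submission
  imports Defs
begin

text \<open>Weak convergence in the space of continuous functions yields convergence of the
  finite-dimensional distributions of the normalized maxima, and taking logarithms of the \<open>n\<close>-th
  powers that independence produces turns this into the asymptotics of the probability that a single
  process exceeds a high level at some of finitely many sites. Inclusion-exclusion gives the
  probability that it exceeds at all of them, whose limit is governed by
  \<open>L = \<integral> min\<^sub>j \<phi>(x - t\<^sub>j) dx\<close>. With levels of
  order \<open>n / k\<close>, Chebyshev's inequality makes the number of exceedances concentrate around \<open>k\<close> times
  the limit; since levels indexed by \<open>1 - \<delta>\<close> and \<open>1 + \<delta>\<close> enclose the order statistic with high
  probability, \<open>R_hat\<close> converges to \<open>L\<close> in probability.

  For a radially decreasing \<open>\<phi>\<close> the bisecting hyperplane of two sites at distance \<open>h\<close> splits the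
  integral into two half-space probabilities, so that \<open>L = 2 (1 - F(\<beta> h / 2))\<close> by rotational symmetry;
  the exponential model in the plane is integrated explicitly. The estimators invert these relations
  and are continuous at \<open>L\<close>.\<close>

section \<open>Order statistics and convergence in probability\<close>

text \<open>The hypothesis concerns maxima of \<open>n\<close> observations, the estimator the
  \<open>k n\<close> largest of them. The link is the block length \<open>m = n div k n\<close>: a
  threshold exceeded with probability about \<open>1 / (m * z)\<close> is exceeded by about
  \<open>k n / z\<close> of the \<open>n\<close> observations. Since the margins are standardized,
  \<open>z = 1\<close> corresponds to the order statistic in question at every site, whatever the
  normalizing functions and \<gamma> are; so a common level \<open>z\<close> at all sites suffices,
  and the estimator, which depends on ranks only, never has to know the margins. Two default values
  shape the details. The fixed value outside the domain of an inverse may cause jumps, so continuity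
  is used at the limit point only. The value 0 of a nonexistent Bochner integral is excluded by the
  standardization of the margins.\<close>

text \<open>In a sorted list the entries above \<open>v\<close> form a final segment, and its length
  decides whether it reaches back to position \<open>j\<close>. This trades order statistics for
  counts of exceedances.\<close>

lemma sorted_nth_le_iff_length_filter:
  fixes xs :: "'a::linorder list"
  assumes "sorted xs" "j < length xs"
  shows "xs ! j \<le> v \<longleftrightarrow> length (filter (\<lambda>y. v < y) xs) < length xs - j"
proof
  assume le: "xs ! j \<le> v"
  have "filter (\<lambda>y. v < y) (take (Suc j) xs) = []"
  proof -
    have "y \<le> v" if y: "y \<in> set (take (Suc j) xs)" for y
    proof -
      obtain i where "i < Suc j" "y = xs ! i"
        using y assms(2) by (auto simp: in_set_conv_nth)
      then show ?thesis
        using sorted_nth_mono[OF assms(1), of i j] assms(2) le by simp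
    qed
    then show ?thesis
      by (auto simp: filter_empty_conv not_less)
  qed
  then have "length (filter (\<lambda>y. v < y) xs) = length (filter (\<lambda>y. v < y) (drop (Suc j) xs))"
    by (metis append_Nil append_take_drop_id filter_append)
  also have "\<dots> \<le> length xs - Suc j"
    by (metis length_drop length_filter_le)
  finally show "length (filter (\<lambda>y. v < y) xs) < length xs - j"
    using assms(2) by linarith
next
  assume lt: "length (filter (\<lambda>y. v < y) xs) < length xs - j"
  show "xs ! j \<le> v"
  proof (rule ccontr)
    assume "\<not> xs ! j \<le> v"
    have "v < y" if y: "y \<in> set (drop j xs)" for y
    proof -
      obtain i where "i < length xs - j" "y = xs ! (j + i)"
        using y by (auto simp: in_set_conv_nth)
      then show ?thesis
        using sorted_nth_mono[OF assms(1), of j "j + i"] \<open>\<not> xs ! j \<le> v\<close> by (simp add: less_diff_conv add.commute)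
    qed
    then have "filter (\<lambda>y. v < y) (drop j xs) = drop j xs"
      by (auto simp: filter_id_conv)
    then have "length xs - j \<le> length (filter (\<lambda>y. v < y) xs)"
      by (metis append_take_drop_id filter_append le_add2 length_append length_drop)
    with lt show False by simp
  qed
qed

text \<open>For \<open>k > n\<close> the truncated subtraction makes the order statistic the minimum, hence the
  \<open>min k n\<close>.\<close>

lemma order_stat_le_iff:
  assumes "1 \<le> n" "1 \<le> k"
  shows "order_stat x (n - k + 1) n \<le> v \<longleftrightarrow> card {l \<in> {1..n}. v < x l} < min k n"
proof -
  let ?xs = "map x [1..<Suc n]"
  have "length (filter (\<lambda>y. v < y) (sort ?xs)) = length (filter (\<lambda>y. v < y) ?xs)"
    by (metis length_sort filter_sort)
  also have "\<dots> = length (filter (\<lambda>l. v < x l) [1..<Suc n])"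
    by (simp only: filter_map length_map o_def)
  also have "\<dots> = card {l \<in> {1..n}. v < x l}"
    by (subst distinct_card[symmetric]) (auto intro!: arg_cong[where f = card])
  finally have *: "length (filter (\<lambda>y. v < y) (sort ?xs)) = card {l \<in> {1..n}. v < x l}" .
  have "length (sort ?xs) - (n - k) = min k n" "n - k < length (sort ?xs)"
    using assms by auto
  then show ?thesis
    using sorted_nth_le_iff_length_filter[of "sort ?xs" "n - k" v]
    unfolding order_stat_def * by simp
qed

section \<open>Calculus of convergence in probability\<close>

text \<open>Continuity is asked for at the limit point only, because the inverse functions inserted
  for \<open>g\<close> may jump to their default value elsewhere. Measurability of the composition
  is then not automatic and becomes a hypothesis.\<close>

lemma (in finite_measure) conv_in_prob_isCont:
  assumes Y: "conv_in_prob M Y y" and g: "isCont g y"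
    and meas: "\<And>n. (\<lambda>\<omega>. g (Y n \<omega>)) \<in> borel_measurable M"
  shows "conv_in_prob M (\<lambda>n \<omega>. g (Y n \<omega>)) (g y)"
  unfolding conv_in_prob_def
proof (intro conjI allI impI meas)
  fix \<epsilon> :: real assume "\<epsilon> > 0"
  then obtain \<delta> where \<delta>: "\<delta> > 0" "\<And>x. \<bar>x - y\<bar> < \<delta> \<Longrightarrow> \<bar>g x - g y\<bar> < \<epsilon>"
    using g unfolding continuous_at_eps_delta dist_real_def by metis
  have [measurable]: "Y n \<in> borel_measurable M" for n
    using Y by (simp add: conv_in_prob_def)
  \<comment> \<open>A large deviation of \<open>g\<close> only yields
    \<open>\<delta> \<le> \<bar>Y n \<omega> - y\<bar>\<close>, while the definition of convergence
    has a strict inequality; \<open>\<delta> / 2\<close> makes room for it.\<close>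
  have "(\<lambda>n. measure M {\<omega>\<in>space M. \<bar>Y n \<omega> - y\<bar> > \<delta> / 2}) \<longlonglongrightarrow> 0"
    using Y \<delta>(1) by (auto simp: conv_in_prob_def simp del: less_divide_eq_numeral1 divide_less_eq_numeral1)
  then show "(\<lambda>n. measure M {\<omega>\<in>space M. \<bar>g (Y n \<omega>) - g y\<bar> > \<epsilon>}) \<longlonglongrightarrow> 0"
  proof (rule tendsto_sandwich[rotated 3, where f = "\<lambda>_. 0"])
    show "\<forall>\<^sub>F n in sequentially. measure M {\<omega> \<in> space M. \<epsilon> < \<bar>g (Y n \<omega>) - g y\<bar>}
        \<le> measure M {\<omega> \<in> space M. \<delta> / 2 < \<bar>Y n \<omega> - y\<bar>}"
    proof (intro always_eventually allI finite_measure_mono subsetI)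
      fix n \<omega> assume "\<omega> \<in> {\<omega> \<in> space M. \<epsilon> < \<bar>g (Y n \<omega>) - g y\<bar>}"
      then show "\<omega> \<in> {\<omega> \<in> space M. \<delta> / 2 < \<bar>Y n \<omega> - y\<bar>}"
        using \<delta>(2)[of "Y n \<omega>"] \<delta>(1) by fastforce
    qed simp
  qed auto
qed

lemma conv_in_prob_const: "conv_in_prob M (\<lambda>n \<omega>. y) y"
  by (simp add: conv_in_prob_def)

lemma (in finite_measure) conv_in_prob_cmult:
  assumes "conv_in_prob M Y y"
  shows "conv_in_prob M (\<lambda>n \<omega>. r * Y n \<omega>) (r * y)"
  by (rule conv_in_prob_isCont[OF assms, where g = "\<lambda>x. r * x"])
     (use assms in \<open>auto simp: conv_in_prob_def intro!: borel_measurable_times\<close>)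

lemma (in finite_measure) conv_in_prob_add:
  assumes Y: "conv_in_prob M Y y" and Z: "conv_in_prob M Z z"
  shows "conv_in_prob M (\<lambda>n \<omega>. Y n \<omega> + Z n \<omega>) (y + z)"
  unfolding conv_in_prob_def
proof (intro conjI allI impI)
  have [measurable]: "Y n \<in> borel_measurable M" "Z n \<in> borel_measurable M" for n
    using Y Z by (simp_all add: conv_in_prob_def)
  show "(\<lambda>\<omega>. Y n \<omega> + Z n \<omega>) \<in> borel_measurable M" for n by simp
  fix \<epsilon> :: real assume "\<epsilon> > 0"
  have "(\<lambda>n. measure M {\<omega>\<in>space M. \<bar>Y n \<omega> - y\<bar> > \<epsilon> / 2} +
      measure M {\<omega>\<in>space M. \<bar>Z n \<omega> - z\<bar> > \<epsilon> / 2}) \<longlonglongrightarrow> 0 + 0"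
    using Y Z \<open>\<epsilon> > 0\<close>
    by (intro tendsto_add) (auto simp: conv_in_prob_def simp del: less_divide_eq_numeral1 divide_less_eq_numeral1)
  then show "(\<lambda>n. measure M {\<omega>\<in>space M. \<bar>Y n \<omega> + Z n \<omega> - (y + z)\<bar> > \<epsilon>}) \<longlonglongrightarrow> 0"
    unfolding add_0
  proof (rule tendsto_sandwich[rotated 3, where f = "\<lambda>_. 0"])
    have "measure M {\<omega> \<in> space M. \<epsilon> < \<bar>Y n \<omega> + Z n \<omega> - (y + z)\<bar>}
        \<le> measure M ({\<omega> \<in> space M. \<epsilon> / 2 < \<bar>Y n \<omega> - y\<bar>} \<union> {\<omega> \<in> space M. \<epsilon> / 2 < \<bar>Z n \<omega> - z\<bar>})"
      for n by (intro finite_measure_mono subsetI) (auto simp: abs_if split: if_splits)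
    also have "\<dots> n \<le> measure M {\<omega> \<in> space M. \<epsilon> / 2 < \<bar>Y n \<omega> - y\<bar>} +
        measure M {\<omega> \<in> space M. \<epsilon> / 2 < \<bar>Z n \<omega> - z\<bar>}" for n
      by (intro measure_Un_le) auto
    finally show "\<forall>\<^sub>F n in sequentially. measure M {\<omega> \<in> space M. \<epsilon> < \<bar>Y n \<omega> + Z n \<omega> - (y + z)\<bar>}
        \<le> measure M {\<omega> \<in> space M. \<epsilon> / 2 < \<bar>Y n \<omega> - y\<bar>} +
           measure M {\<omega> \<in> space M. \<epsilon> / 2 < \<bar>Z n \<omega> - z\<bar>}"
      by (intro always_eventually allI)
  qed auto
qed

lemma (in finite_measure) conv_in_prob_sum:
  assumes "\<And>i. i \<in> I \<Longrightarrow> conv_in_prob M (Y i) (y i)"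
  shows "conv_in_prob M (\<lambda>n \<omega>. \<Sum>i\<in>I. Y i n \<omega>) (\<Sum>i\<in>I. y i)"
  using assms
  by (induction I rule: infinite_finite_induct)
     (simp_all add: conv_in_prob_const conv_in_prob_add)

text \<open>A continuous injection maps a neighbourhood of \<open>y\<close> onto a neighbourhood of
  \<open>f y\<close>, so the default value \<open>c\<close> is not seen close to
  \<open>f y\<close>.\<close>

lemma isCont_inverse_fun:
  assumes D: "open D" "inj_on f D" "continuous_on D f" and y: "y \<in> D"
  shows "isCont (inverse_fun D f c) (f y)" and "inverse_fun D f c (f y) = y"
proof -
  have inv: "inverse_fun D f c (f z) = z" if "z \<in> D" for z
    using that D(2) by (simp add: inverse_fun_def)
  then show "inverse_fun D f c (f y) = y" using y by simp
  obtain d where d: "d > 0" "\<And>z. \<bar>z - y\<bar> \<le> d \<Longrightarrow> z \<in> D"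
    using D(1) y unfolding open_contains_cball by (auto simp: subset_eq dist_real_def abs_minus_commute)
  show "isCont (inverse_fun D f c) (f y)"
    by (rule isCont_inverse_function[OF d(1)])
       (use d(2) D inv in \<open>auto simp: continuous_on_eq_continuous_at\<close>)
qed

section \<open>Finite-dimensional convergence of the maxima\<close>

lemma continuous_map_C_top_eval: "continuous_map C_top euclideanreal (\<lambda>f. f t)"
  unfolding continuous_map_def
proof (intro conjI allI impI)
  fix U :: "real set" assume "openin euclideanreal U"
  then have U: "open U" by simp
  show "openin C_top {f \<in> topspace C_top. f t \<in> U}"
    unfolding openin_C_top C_open_def
  proof (intro conjI ballI)
    fix f assume "f \<in> {f \<in> topspace C_top. f t \<in> U}"
    then have "f t \<in> U" by simp
    then obtain e where e: "e > 0" "\<And>y. \<bar>y - f t\<bar> < e \<Longrightarrow> y \<in> U"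
      using U unfolding open_dist dist_real_def by metis
    have "C_nbhd f {t} e \<subseteq> {f \<in> topspace C_top. f t \<in> U}"
      using e(2) by (auto simp: C_nbhd_def topspace_C_top)
    then show "\<exists>K \<epsilon>. compact K \<and> \<epsilon> > 0 \<and> C_nbhd f K \<epsilon> \<subseteq> {f \<in> topspace C_top. f t \<in> U}"
      using e(1) by (intro exI[of _ "{t}"] exI[of _ e]) simp
  qed (auto simp: topspace_C_top)
qed auto

lemma continuous_map_MAX:
  fixes f :: "'i \<Rightarrow> 'a \<Rightarrow> real"
  assumes "finite S" "S \<noteq> {}" "\<And>s. s \<in> S \<Longrightarrow> continuous_map T euclideanreal (f s)"
  shows "continuous_map T euclideanreal (\<lambda>x. MAX s\<in>S. f s x)"
  using assms
proof (induction S rule: finite_ne_induct)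
  case (insert s S)
  then have "continuous_map T euclideanreal (\<lambda>x. max (f s x) (MAX s\<in>S. f s x))"
    by (intro continuous_map_real_max insert.IH insert.prems insertI1 insertI2)
  then show ?case using insert.hyps by simp
qed simp

section \<open>Generalized extreme value margins and unit Frechet margins\<close>

text \<open>On \<open>z > 0\<close> this inverts \<open>gev_to_frechet g\<close>: it carries a level
  on the unit Frechet scale to a level for the standardized limit. The formula is the Box-Cox
  transformation.\<close>

definition gev_quantile :: "real \<Rightarrow> real \<Rightarrow> real" where
  "gev_quantile g z = (if g = 0 then ln z else (z powr g - 1) / g)"

lemma measurable_gev_to_frechet [measurable]: "gev_to_frechet g \<in> borel_measurable borel"
  unfolding gev_to_frechet_def[abs_def] by measurable

lemma gev_quantile_pos: "z > 0 \<Longrightarrow> 1 + g * gev_quantile g z > 0"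
  by (simp add: gev_quantile_def)

lemma gev_cdf_gev_quantile: "z > 0 \<Longrightarrow> gev_cdf g (gev_quantile g z) = exp (- (1 / z))"
proof (cases "g = 0")
  case False
  assume "z > 0"
  have "(z powr g) powr (- 1 / g) = z powr (- 1)"
    using False by (simp add: powr_powr)
  also have "\<dots> = 1 / z"
    using \<open>z > 0\<close> by (simp add: powr_minus_divide)
  finally show ?thesis
    using False by (simp add: gev_cdf_def gev_quantile_def)
qed (simp add: gev_cdf_def gev_quantile_def exp_minus inverse_eq_divide)

lemma gev_to_frechet_le_iff:
  assumes "z > 0" "1 + g * x > 0"
  shows "gev_to_frechet g x \<le> z \<longleftrightarrow> x \<le> gev_quantile g z"
proof -
  consider "g = 0" | "g > 0" | "g < 0" by linarith
  then show ?thesis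
  proof cases
    case 1 then show ?thesis
      using assms by (simp add: gev_to_frechet_def gev_quantile_def ln_ge_iff)
  next
    case 2
    have "(1 + g * x) powr (1 / g) \<le> z \<longleftrightarrow> 1 + g * x \<le> z powr g"
    proof
      assume "(1 + g * x) powr (1 / g) \<le> z"
      then have "((1 + g * x) powr (1 / g)) powr g \<le> z powr g"
        using 2 by (intro powr_mono2) auto
      then show "1 + g * x \<le> z powr g" using 2 assms by (simp add: powr_powr)
    next
      assume "1 + g * x \<le> z powr g"
      then have "(1 + g * x) powr (1 / g) \<le> (z powr g) powr (1 / g)"
        using 2 assms by (intro powr_mono2) auto
      then show "(1 + g * x) powr (1 / g) \<le> z" using 2 assms by (simp add: powr_powr)
    qed
    then show ?thesis using 2 assms
      by (simp add: gev_to_frechet_def gev_quantile_def pos_le_divide_eq algebra_simps)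
  next
    case 3
    \<comment> \<open>For negative \<open>g\<close> the power reverses the inequality, and the later
      division by \<open>g\<close> reverses it back.\<close>
    have "(1 + g * x) powr (1 / g) \<le> z \<longleftrightarrow> z powr g \<le> 1 + g * x"
    proof
      assume "(1 + g * x) powr (1 / g) \<le> z"
      then have "z powr g \<le> ((1 + g * x) powr (1 / g)) powr g"
        using 3 assms by (intro powr_mono2') auto
      then show "z powr g \<le> 1 + g * x" using 3 assms by (simp add: powr_powr)
    next
      assume "z powr g \<le> 1 + g * x"
      then have "(1 + g * x) powr (1 / g) \<le> (z powr g) powr (1 / g)"
        using 3 assms by (intro powr_mono2') auto
      then show "(1 + g * x) powr (1 / g) \<le> z" using 3 assms by (simp add: powr_powr)
    qed
    then show ?thesis using 3 assms
      by (simp add: gev_to_frechet_def gev_quantile_def neg_le_divide_eq algebra_simps)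
  qed
qed

section \<open>Finite-dimensional laws of the limit process\<close>

context max_attraction begin

lemma measurable_X_process: "i \<ge> 1 \<Longrightarrow> X i \<in> M \<rightarrow>\<^sub>M (\<Pi>\<^sub>M t\<in>UNIV. borel)"
  using indep_X by (simp add: indep_vars_def)

lemma measurable_X [measurable (raw)]: "i \<ge> 1 \<Longrightarrow> (\<lambda>\<omega>. X i \<omega> t) \<in> borel_measurable M"
  using measurable_compose[OF measurable_X_process measurable_component_singleton[OF UNIV_I]] .

lemma measurable_Zt_eval [measurable]: "(\<lambda>\<omega>. Zt \<omega> t) \<in> borel_measurable N"
  by (rule measurable_compose[OF measurable_Zt measurable_component_singleton[OF UNIV_I]])

text \<open>The marginal law is given only where \<open>1 + \<gamma> t * x > 0\<close>, but this
  condition is open, so the distribution function agrees with a continuous one near \<open>x\<close>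
  and has no atom there.\<close>

lemma prob_Zt_eq_0:
  assumes x: "1 + \<gamma> t * x > 0"
  shows "measure N {\<omega> \<in> space N. Zt \<omega> t = x} = 0"
proof -
  let ?D = "distr N borel (\<lambda>\<omega>. Zt \<omega> t)"
  interpret D: real_distribution ?D by (rule limit.real_distribution_distr) simp
  have "cdf ?D y = gev_cdf (\<gamma> t) y" if "1 + \<gamma> t * y > 0" for y
    using marginal_Zt[OF that] by (simp add: cdf_def measure_distr vimage_def Int_def conj_commute)
  moreover have "\<forall>\<^sub>F y in nhds x. 1 + \<gamma> t * y > 0"
    by (rule order_tendstoD(1)[OF _ x]) (intro tendsto_intros filterlim_ident)
  ultimately have "\<forall>\<^sub>F y in nhds x. cdf ?D y = gev_cdf (\<gamma> t) y"
    by (auto elim: eventually_mono)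
  moreover have "isCont (gev_cdf (\<gamma> t)) x"
    using x by (cases "\<gamma> t = 0") (auto simp: gev_cdf_def[abs_def] intro!: continuous_intros)
  ultimately have "isCont (cdf ?D) x"
    by (simp add: isCont_cong)
  then have "measure ?D {x} = 0" by (simp add: D.isCont_cdf)
  then show ?thesis by (simp add: measure_distr vimage_def Int_def conj_commute)
qed

text \<open>For negative shape parameter this makes the junk value of \<open>gev_to_frechet\<close> beyond the right
  end point harmless.\<close>

lemma AE_Zt_domain: "AE \<omega> in N. 1 + \<gamma> t * Zt \<omega> t > 0 \<or> \<gamma> t > 0"
proof (cases "\<gamma> t < 0")
  case True
  \<comment> \<open>These points increase to the right end point \<open>- 1 / \<gamma> t\<close>
    while staying inside the domain of the marginal formula, whose values along them tend to
    1.\<close>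
  define e where "e n = (1 / real (Suc n) - 1) / \<gamma> t" for n
  have e: "1 + \<gamma> t * e n = 1 / real (Suc n)" for n
    using True by (simp add: e_def)
  have "measure N {\<omega>\<in>space N. 1 + \<gamma> t * Zt \<omega> t > 0} \<ge> exp (- ((1 / real (Suc n)) powr (- 1 / \<gamma> t)))" for n
  proof -
    have "exp (- ((1 / real (Suc n)) powr (- 1 / \<gamma> t))) = measure N {\<omega>\<in>space N. Zt \<omega> t \<le> e n}"
      using marginal_Zt[of t "e n"] True e[of n] by (simp add: gev_cdf_def)
    also have "\<dots> \<le> measure N {\<omega>\<in>space N. 1 + \<gamma> t * Zt \<omega> t > 0}"
    proof (intro limit.finite_measure_mono subsetI)
      fix \<omega> assume "\<omega> \<in> {\<omega>\<in>space N. Zt \<omega> t \<le> e n}"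
      then have "\<omega> \<in> space N" "\<gamma> t * e n \<le> \<gamma> t * Zt \<omega> t"
        using True by auto
      moreover have "0 < 1 + \<gamma> t * e n" using e[of n] by simp
      ultimately show "\<omega> \<in> {\<omega>\<in>space N. 1 + \<gamma> t * Zt \<omega> t > 0}"
        by simp
    qed simp
    finally show ?thesis .
  qed
  moreover have "(\<lambda>n. exp (- ((1 / real (Suc n)) powr (- 1 / \<gamma> t)))) \<longlonglongrightarrow> exp (- (0 powr (- 1 / \<gamma> t)))"
    using True by (intro tendsto_intros tendsto_powr' LIMSEQ_Suc[OF lim_1_over_n]) (auto simp: divide_neg_neg)
  ultimately have "measure N {\<omega>\<in>space N. 1 + \<gamma> t * Zt \<omega> t > 0} \<ge> 1"
    by (intro LIMSEQ_le_const2[where X = "\<lambda>n. exp (- ((1 / real (Suc n)) powr (- 1 / \<gamma> t)))"]) auto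
   then have "measure N {\<omega>\<in>space N. 1 + \<gamma> t * Zt \<omega> t > 0} = 1"
    by (simp add: antisym)
  then have "AE \<omega> in N. 1 + \<gamma> t * Zt \<omega> t > 0"
    by (subst (asm) limit.prob_Collect_eq_1) auto
  then show ?thesis by eventually_elim simp
qed (auto simp: not_less le_less)

lemma AE_frechet_le_iff:
  assumes "z > 0"
  shows "AE \<omega> in N. gev_to_frechet (\<gamma> t) (Zt \<omega> t) \<le> z \<longleftrightarrow> Zt \<omega> t \<le> gev_quantile (\<gamma> t) z"
  using AE_Zt_domain[of t]
proof eventually_elim
  case (elim \<omega>)
  show ?case
  proof (cases "1 + \<gamma> t * Zt \<omega> t > 0")
    case True then show ?thesis using gev_to_frechet_le_iff[OF assms] by simp
  next
    \<comment> \<open>At or below the left end point both sides hold: the Frechet value is 0, and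
      \<open>Zt \<omega> t\<close> is smaller than the quantile.\<close>
    case False
    with elim have "\<gamma> t > 0" by simp
    have "\<gamma> t * Zt \<omega> t \<le> \<gamma> t * gev_quantile (\<gamma> t) z"
      using False gev_quantile_pos[OF assms, of "\<gamma> t"] by linarith
    then have "Zt \<omega> t \<le> gev_quantile (\<gamma> t) z"
      using \<open>\<gamma> t > 0\<close> by simp
    moreover have "gev_to_frechet (\<gamma> t) (Zt \<omega> t) = 0"
      using False \<open>\<gamma> t > 0\<close> by (simp add: gev_to_frechet_def max_def)
    ultimately show ?thesis using assms by simp
  qed
qed

lemma exponent_measure:
  assumes S: "finite S" "S \<noteq> {}" and z: "z > 0"
  shows "measure N {\<omega>\<in>space N. \<forall>t\<in>S. Zt \<omega> t \<le> gev_quantile (\<gamma> t) z}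
    = exp (- ((\<integral>s. (MAX t\<in>S. \<phi> (s - t)) \<partial>lborel) / z))"
proof -
  \<comment> \<open>The sites are enumerated because \<open>moving_maximum\<close> indexes them by
    \<open>{1..d}\<close>.\<close>
  obtain h where h: "bij_betw h {1..card S} S"
    using S(1) ex_bij_betw_nat_finite_1 by blast
  then have hS: "h ` {1..card S} = S" by (simp add: bij_betw_def)
  have d: "1 \<le> card S" using S by (simp add: Suc_le_eq card_gt_0_iff)
  have ae: "AE \<omega> in N. \<forall>t\<in>S. gev_to_frechet (\<gamma> t) (Zt \<omega> t) \<le> z \<longleftrightarrow> Zt \<omega> t \<le> gev_quantile (\<gamma> t) z"
    using S(1) z by (intro AE_finite_allI AE_frechet_le_iff)
  have "measure N {\<omega>\<in>space N. \<forall>t\<in>S. Zt \<omega> t \<le> gev_quantile (\<gamma> t) z}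
      = measure N {\<omega>\<in>space N. \<forall>t\<in>S. gev_to_frechet (\<gamma> t) (Zt \<omega> t) \<le> z}"
  proof (intro limit.finite_measure_eq_AE)
    show "AE \<omega> in N. (\<omega> \<in> {\<omega>\<in>space N. \<forall>t\<in>S. Zt \<omega> t \<le> gev_quantile (\<gamma> t) z}) =
        (\<omega> \<in> {\<omega>\<in>space N. \<forall>t\<in>S. gev_to_frechet (\<gamma> t) (Zt \<omega> t) \<le> z})"
      using ae by eventually_elim auto
    show "{\<omega>\<in>space N. \<forall>t\<in>S. Zt \<omega> t \<le> gev_quantile (\<gamma> t) z} \<in> limit.events"
      using S(1) by measurable
    show "{\<omega>\<in>space N. \<forall>t\<in>S. gev_to_frechet (\<gamma> t) (Zt \<omega> t) \<le> z} \<in> limit.events"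
      using S(1) by measurable
  qed
  also have "\<dots> = measure N {\<omega>\<in>space N. \<forall>i\<in>{1..card S}. gev_to_frechet (\<gamma> (h i)) (Zt \<omega> (h i)) \<le> z}"
    by (subst hS[symmetric]) simp
  also have "\<dots> = exp (- (\<integral>s. (MAX i\<in>{1..card S}. \<phi> (s - h i) / z) \<partial>lborel))"
    using moving_maximum_Z[unfolded moving_maximum_def, rule_format, OF d, where x = "\<lambda>_. z"] z by simp
  also have "(\<lambda>s. MAX i\<in>{1..card S}. \<phi> (s - h i) / z) = (\<lambda>s. (MAX t\<in>S. \<phi> (s - t)) / z)"
  proof
    fix s
    have "(MAX t\<in>S. \<phi> (s - t)) / z = Max ((\<lambda>y. y / z) ` (\<lambda>t. \<phi> (s - t)) ` S)"
      using S z by (intro mono_Max_commute) (auto simp: mono_def divide_right_mono)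
    also have "(\<lambda>y. y / z) ` (\<lambda>t. \<phi> (s - t)) ` S = (\<lambda>i. \<phi> (s - h i) / z) ` {1..card S}"
      by (subst hS[symmetric]) (simp add: image_image)
    finally show "(MAX i\<in>{1..card S}. \<phi> (s - h i) / z) = (MAX t\<in>S. \<phi> (s - t)) / z" by simp
  qed
  finally show ?thesis by simp
qed

text \<open>At level 1 the moving maximum formula for one site and the standardized margin describe
  the same probability \<open>exp (- 1)\<close>; comparing exponents gives the mass.\<close>

lemma integral_\<phi>_shift: "(\<integral>s. \<phi> (s - t) \<partial>lborel) = 1"
proof -
  have "exp (- ((\<integral>s. \<phi> (s - t) \<partial>lborel) / 1)) = gev_cdf (\<gamma> t) (gev_quantile (\<gamma> t) 1)"
    using exponent_measure[of "{t}" 1] marginal_Zt[OF gev_quantile_pos[of 1 "\<gamma> t"]] by simp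
  then show ?thesis by (simp add: gev_cdf_gev_quantile)
qed

text \<open>A Bochner integral that does not exist has value 0, so the value 1 certifies
  integrability.\<close>

lemma integrable_\<phi>_shift: "integrable lborel (\<lambda>s. \<phi> (s - t))"
  by (rule ccontr) (use integral_\<phi>_shift[of t] in \<open>simp add: not_integrable_integral_eq\<close>)

section \<open>Thresholds and convergence of the maxima at finitely many sites\<close>

text \<open>Chosen such that one observation exceeds \<open>level n z t\<close> with probability
  about \<open>1 / (n * z)\<close>; a larger \<open>z\<close> means a higher threshold.\<close>

definition level :: "nat \<Rightarrow> real \<Rightarrow> 'e \<Rightarrow> real" where
  "level n z t = b n t + a n t * gev_quantile (\<gamma> t) z"

text \<open>Joint non-exceedance says that a single continuous functional, the maximum over
  \<open>S\<close> of the coordinates centred at their thresholds, is nonpositive. Weak convergence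
  of real random variables therefore suffices.\<close>

lemma fidis_convergence:
  assumes S: "finite S" "S \<noteq> {}" and z: "z > 0"
  shows "(\<lambda>n. prob {\<omega>\<in>space M. \<forall>t\<in>S. (MAX i\<in>{1..n}. X i \<omega> t) \<le> level n z t})
    \<longlonglongrightarrow> exp (- ((\<integral>s. (MAX t\<in>S. \<phi> (s - t)) \<partial>lborel) / z))"
proof -
  define q where "q t = gev_quantile (\<gamma> t) z" for t
  \<comment> \<open>The index is shifted by one because nothing is assumed about \<open>a 0\<close>,
    and a maximum over no observations is meaningless.\<close>
  define W where "W n \<omega> = (MAX t\<in>S. ((MAX i\<in>{1..Suc n}. X i \<omega> t) - b (Suc n) t) / a (Suc n) t - q t)" for n \<omega>
  define W' where "W' \<omega> = (MAX t\<in>S. Zt \<omega> t - q t)" for \<omega>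
  have [measurable]: "W n \<in> borel_measurable M" for n
    unfolding W_def using S(1)
    by (intro borel_measurable_Max borel_measurable_diff borel_measurable_divide borel_measurable_const
        measurable_X finite_atLeastAtMost) simp_all
  have [measurable]: "W' \<in> borel_measurable N"
    unfolding W'_def using S(1)
    by (intro borel_measurable_Max borel_measurable_diff borel_measurable_const measurable_Zt_eval)
  \<comment> \<open>Test functionals must be continuous, so indicators of half lines are replaced by
    piecewise linear steps.\<close>
  have weak: "weak_conv_m (\<lambda>n. distr M borel (W n)) (distr N borel W')"
  proof (rule integral_cts_step_conv_imp_weak_conv)
    fix x y :: real assume xy: "x < y"
    define H where "H f = cts_step x y (MAX t\<in>S. f t - q t)" for f :: "'e \<Rightarrow> real"
    have cts [measurable]: "cts_step x y \<in> borel_measurable borel"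
      using cts_step_uniformly_continuous[OF xy]
      by (intro borel_measurable_continuous_onI uniformly_continuous_imp_continuous)
    have W: "H (\<lambda>t. ((MAX i\<in>{1..Suc n}. X i \<omega> t) - b (Suc n) t) / a (Suc n) t) = cts_step x y (W n \<omega>)" for n \<omega>
      by (simp only: H_def W_def)
    have W': "H (Zt \<omega>) = cts_step x y (W' \<omega>)" for \<omega>
      by (simp only: H_def W'_def)
    have "continuous_map euclideanreal euclideanreal (cts_step x y)"
      using cts_step_uniformly_continuous[OF xy] by (simp add: uniformly_continuous_imp_continuous)
    moreover have "continuous_map C_top euclideanreal (\<lambda>f. MAX t\<in>S. f t - q t)"
      using S by (intro continuous_map_MAX continuous_map_diff continuous_map_C_top_eval) auto
    ultimately have "continuous_map C_top euclideanreal H"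
      unfolding H_def using continuous_map_compose[unfolded o_def] by blast
    moreover have "bounded (H ` topspace C_top)"
      using xy by (intro boundedI[of _ 1]) (auto simp: H_def cts_step_def field_simps)
    ultimately have "(\<lambda>n. \<integral>\<omega>. H (\<lambda>t. ((MAX i\<in>{1..n}. X i \<omega> t) - b n t) / a n t) \<partial>M)
        \<longlonglongrightarrow> (\<integral>\<omega>. H (Zt \<omega>) \<partial>N)"
      using weak_limit unfolding weak_conv_C_def by blast
    then have "(\<lambda>n. \<integral>\<omega>. H (\<lambda>t. ((MAX i\<in>{1..Suc n}. X i \<omega> t) - b (Suc n) t) / a (Suc n) t) \<partial>M)
        \<longlonglongrightarrow> (\<integral>\<omega>. H (Zt \<omega>) \<partial>N)"
      by (rule LIMSEQ_Suc)
    then show "(\<lambda>n. integral\<^sup>L (distr M borel (W n)) (cts_step x y))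
        \<longlonglongrightarrow> integral\<^sup>L (distr N borel W') (cts_step x y)"
      unfolding W W' by (simp add: integral_distr)
  qed (auto intro: real_distribution_distr limit.real_distribution_distr)
  interpret D: real_distribution "distr N borel W'"
    by (rule limit.real_distribution_distr) simp
  \<comment> \<open>Distribution functions converge at 0 only if the limit has no atom there;
    \<open>W' \<omega> = 0\<close> forces some coordinate to hit its threshold exactly.\<close>
  have "measure N {\<omega>\<in>space N. W' \<omega> = 0} \<le> measure N (\<Union>t\<in>S. {\<omega>\<in>space N. Zt \<omega> t = q t})"
  proof (intro limit.finite_measure_mono subsetI)
    fix \<omega> assume "\<omega> \<in> {\<omega>\<in>space N. W' \<omega> = 0}"
    then have "\<omega> \<in> space N" "0 \<in> (\<lambda>t. Zt \<omega> t - q t) ` S"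
      using Max_in[of "(\<lambda>t. Zt \<omega> t - q t) ` S"] S by (auto simp: W'_def)
    then show "\<omega> \<in> (\<Union>t\<in>S. {\<omega>\<in>space N. Zt \<omega> t = q t})" by auto
  qed (use S in auto)
  also have "\<dots> \<le> (\<Sum>t\<in>S. measure N {\<omega>\<in>space N. Zt \<omega> t = q t})"
    using S by (intro limit.finite_measure_subadditive_finite) auto
  also have "\<dots> = 0"
    by (intro sum.neutral ballI) (simp add: prob_Zt_eq_0 q_def gev_quantile_pos z)
  finally have "measure N (W' -` {0} \<inter> space N) = 0"
    by (simp add: vimage_def Int_def conj_commute measure_le_0_iff)
  then have "isCont (cdf (distr N borel W')) 0"
    by (simp add: D.isCont_cdf measure_distr)
  with weak have "(\<lambda>n. cdf (distr M borel (W n)) 0) \<longlonglongrightarrow> cdf (distr N borel W') 0"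
    by (simp add: weak_conv_m_def weak_conv_def)
  moreover have "cdf (distr N borel W') 0 = exp (- ((\<integral>s. (MAX t\<in>S. \<phi> (s - t)) \<partial>lborel) / z))"
  proof -
    have "W' \<omega> \<le> 0 \<longleftrightarrow> (\<forall>t\<in>S. Zt \<omega> t \<le> q t)" for \<omega>
      unfolding W'_def by (subst Max_le_iff) (use S in auto)
    then have "W' -` {..0} \<inter> space N = {\<omega>\<in>space N. \<forall>t\<in>S. Zt \<omega> t \<le> q t}"
      by blast
    moreover have "cdf (distr N borel W') 0 = limit.prob (W' -` {..0} \<inter> space N)"
      unfolding cdf_def by (intro measure_distr) auto
    ultimately show ?thesis
      unfolding exponent_measure[OF S z, symmetric] q_def by (simp only:)
  qed
  moreover have "cdf (distr M borel (W n)) 0 =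
      prob {\<omega>\<in>space M. \<forall>t\<in>S. (MAX i\<in>{1..Suc n}. X i \<omega> t) \<le> level (Suc n) z t}" for n
  proof -
    have iff: "((y - b (Suc n) t) / a (Suc n) t - q t \<le> 0) \<longleftrightarrow> y \<le> level (Suc n) z t" for y t
      using a_pos[of "Suc n" t] by (simp add: level_def q_def field_simps)
    have "W n \<omega> \<le> 0 \<longleftrightarrow> (\<forall>t\<in>S. (MAX i\<in>{1..Suc n}. X i \<omega> t) \<le> level (Suc n) z t)" for \<omega>
      unfolding W_def iff[symmetric] by (subst Max_le_iff) (use S in auto)
    then have "W n -` {..0} \<inter> space M =
        {\<omega>\<in>space M. \<forall>t\<in>S. (MAX i\<in>{1..Suc n}. X i \<omega> t) \<le> level (Suc n) z t}"
      by blast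
    moreover have "cdf (distr M borel (W n)) 0 = prob (W n -` {..0} \<inter> space M)"
      unfolding cdf_def by (intro measure_distr) auto
    ultimately show ?thesis by (simp only:)
  qed
  ultimately show ?thesis
    by - (rule LIMSEQ_imp_Suc, simp only:)
qed

end

section \<open>Exceedance probabilities\<close>

text \<open>Both bounds come from \<open>ln x \<le> x - 1\<close>, once at \<open>q n\<close> and
  once at \<open>1 / q n\<close>: they enclose \<open>n * (1 - q n)\<close> between
  \<open>q n * l n\<close> and \<open>l n\<close>.\<close>

lemma tendsto_mult_one_minus_of_power:
  fixes q :: "nat \<Rightarrow> real"
  assumes q: "\<And>n. 0 \<le> q n" and lim: "(\<lambda>n. q n ^ n) \<longlonglongrightarrow> exp (- v)"
  shows "(\<lambda>n. real n * (1 - q n)) \<longlonglongrightarrow> v"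
proof -
  define l where "l n = - ln (q n ^ n)" for n
  have l: "l \<longlonglongrightarrow> v"
    unfolding l_def using tendsto_minus[OF tendsto_ln[OF lim]] by simp
  have "\<forall>\<^sub>F n in sequentially. q n ^ n > 0"
    using order_tendstoD(1)[OF lim] by simp
  then have ev: "\<forall>\<^sub>F n in sequentially. q n > 0 \<and> l n = - (real n * ln (q n)) \<and> n \<ge> 1"
    using eventually_ge_at_top[of 1]
  proof eventually_elim
    case (elim n)
    have "q n \<noteq> 0" using elim by (auto simp: power_0_left)
    then show ?case using q[of n] elim by (simp add: l_def ln_realpow)
  qed
  \<comment> \<open>As \<open>l n\<close> converges, \<open>q n = exp (- (l n / n))\<close> tends to
    1, so the two bounds share their limit.\<close>
  have "(\<lambda>n. exp (- (l n / real n))) \<longlonglongrightarrow> exp (- 0)"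
    by (intro tendsto_intros real_tendsto_divide_at_top[OF l] filterlim_real_sequentially)
  moreover have "\<forall>\<^sub>F n in sequentially. exp (- (l n / real n)) = q n"
    using ev by eventually_elim simp
  ultimately have "q \<longlonglongrightarrow> 1"
    by (simp add: tendsto_cong)
  then have "(\<lambda>n. q n * l n) \<longlonglongrightarrow> 1 * v"
    using l by (rule tendsto_mult)
  then have lower: "(\<lambda>n. q n * l n) \<longlonglongrightarrow> v" by simp
  show ?thesis
  proof (rule tendsto_sandwich[OF _ _ lower l])
    show "\<forall>\<^sub>F n in sequentially. real n * (1 - q n) \<le> l n"
      using ev
    proof eventually_elim
      case (elim n)
      then have "real n * ln (q n) \<le> real n * (q n - 1)"
        by (intro mult_left_mono ln_le_minus_one) auto
      with elim show ?case by (simp add: algebra_simps)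
    qed
    show "\<forall>\<^sub>F n in sequentially. q n * l n \<le> real n * (1 - q n)"
      using ev
    proof eventually_elim
      case (elim n)
      then have "- ln (q n) \<le> 1 / q n - 1"
        using ln_le_minus_one[of "1 / q n"] by (simp add: ln_div)
      then have "q n * (- ln (q n)) \<le> q n * (1 / q n - 1)"
        using elim by (intro mult_left_mono) auto
      also have "\<dots> = 1 - q n" using elim by (simp add: algebra_simps)
      finally have "real n * (q n * (- ln (q n))) \<le> real n * (1 - q n)"
        by (intro mult_left_mono) auto
      with elim show ?case by (simp add: algebra_simps)
    qed
  qed
qed

text \<open>Pairwise independence keeps the variance of the count below its mean. With mean and
  deviation both of order \<open>k\<close>, the bound is of order \<open>1 / k\<close>.\<close>

lemma (in prob_space) prob_card_deviation_le:
  assumes I: "finite I" and E: "\<And>i. i \<in> I \<Longrightarrow> E i \<in> events" "\<And>i. i \<in> I \<Longrightarrow> prob (E i) = p"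
    and pair: "\<And>i j. i \<in> I \<Longrightarrow> j \<in> I \<Longrightarrow> i \<noteq> j \<Longrightarrow> prob (E i \<inter> E j) = p\<^sup>2"
    and c: "c > 0"
  shows "prob {\<omega>\<in>space M. c \<le> \<bar>real (card {i\<in>I. \<omega> \<in> E i}) - real (card I) * p\<bar>} \<le> real (card I) * p / c\<^sup>2"
proof -
  define C where "C \<omega> = (\<Sum>i\<in>I. indicator (E i) \<omega> :: real)" for \<omega>
  have C_eq: "C \<omega> = real (card {i\<in>I. \<omega> \<in> E i})" for \<omega>
    using I by (simp add: C_def indicator_def sum.If_cases Int_def)
  have [measurable]: "C \<in> borel_measurable M"
    unfolding C_def using E by (intro borel_measurable_sum borel_measurable_indicator) auto
  have C_bound: "\<bar>C \<omega>\<bar> \<le> real (card I)" for \<omega>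
    unfolding C_eq using I by (auto intro!: card_mono)
  have int: "integrable M C"
    by (rule integrable_const_bound[of _ "real (card I)"]) (use C_bound in auto)
  have int2: "integrable M (\<lambda>\<omega>. (C \<omega>)\<^sup>2)"
    by (rule integrable_const_bound[of _ "(real (card I))\<^sup>2"])
       (use C_bound in \<open>auto simp: abs_le_square_iff[symmetric]\<close>)
  have exp_C: "expectation C = real (card I) * p"
    unfolding C_def using E by (subst Bochner_Integration.integral_sum) (auto simp: emeasure_eq_measure)
  have "expectation (\<lambda>\<omega>. (C \<omega>)\<^sup>2) = expectation (\<lambda>\<omega>. \<Sum>i\<in>I. \<Sum>j\<in>I. indicator (E i \<inter> E j) \<omega>)"
    by (simp add: C_def power2_eq_square sum_product indicator_inter_arith)
  also have "\<dots> = (\<Sum>i\<in>I. \<Sum>j\<in>I. prob (E i \<inter> E j))"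
    using E by (subst Bochner_Integration.integral_sum)
      (auto intro!: sum.cong Bochner_Integration.integrable_sum simp: emeasure_eq_measure Bochner_Integration.integral_sum)
  also have "\<dots> \<le> (\<Sum>i\<in>I. p + real (card I) * p\<^sup>2)"
  proof (rule sum_mono)
    fix i assume i: "i \<in> I"
    have "(\<Sum>j\<in>I. prob (E i \<inter> E j)) = prob (E i) + (\<Sum>j\<in>I - {i}. prob (E i \<inter> E j))"
      using I i by (subst sum.remove[of _ i]) auto
    also have "(\<Sum>j\<in>I - {i}. prob (E i \<inter> E j)) = (\<Sum>j\<in>I - {i}. p\<^sup>2)"
      using i by (intro sum.cong refl pair) auto
    also have "\<dots> = real (card (I - {i})) * p\<^sup>2"
      by simp
    \<comment> \<open>Replacing \<open>card I - 1\<close> by \<open>card I\<close> costs little and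
      makes the double sum cancel the squared mean exactly.\<close>
    also have "\<dots> \<le> real (card I) * p\<^sup>2"
      using I by (intro mult_right_mono) (auto intro!: card_mono)
    finally show "(\<Sum>j\<in>I. prob (E i \<inter> E j)) \<le> p + real (card I) * p\<^sup>2"
      using E i by simp
  qed
  also have "\<dots> = real (card I) * p + (real (card I) * p)\<^sup>2"
    by (simp add: power2_eq_square algebra_simps)
  finally have "variance C \<le> real (card I) * p"
    unfolding variance_eq[OF int int2] by (simp add: exp_C)
  then have "variance C / c\<^sup>2 \<le> real (card I) * p / c\<^sup>2"
    by (intro divide_right_mono) auto
  moreover have "prob {\<omega>\<in>space M. c \<le> \<bar>C \<omega> - expectation C\<bar>} \<le> variance C / c\<^sup>2"
    using int2 c by (intro Chebyshev_inequality) auto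
  ultimately show ?thesis
    by (simp add: exp_C C_eq)
qed

text \<open>Only the finitely many coordinates in \<open>S\<close> matter, which keeps the set
  measurable although the index set of the product may be uncountable.\<close>

lemma exceedance_set [measurable]:
  "finite S \<Longrightarrow> {f. \<forall>s\<in>S. u s < f s} \<in> sets (\<Pi>\<^sub>M t\<in>(UNIV :: 'a set). (borel :: real measure))"
proof -
  assume "finite S"
  have [measurable]: "(\<lambda>f. f s) \<in> borel_measurable (\<Pi>\<^sub>M t\<in>(UNIV :: 'a set). (borel :: real measure))" for s
    by (rule measurable_component_singleton) simp
  have "{f \<in> space (\<Pi>\<^sub>M t\<in>(UNIV :: 'a set). (borel :: real measure)). \<forall>s\<in>S. u s < f s}
      \<in> sets (\<Pi>\<^sub>M t\<in>(UNIV :: 'a set). (borel :: real measure))"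
    using \<open>finite S\<close> by measurable
  then show ?thesis by (simp add: space_PiM)
qed

lemma non_exceedance_set [measurable]:
  "finite S \<Longrightarrow> {f. \<forall>s\<in>S. f s \<le> u s} \<in> sets (\<Pi>\<^sub>M t\<in>(UNIV :: 'a set). (borel :: real measure))"
proof -
  assume "finite S"
  have [measurable]: "(\<lambda>f. f s) \<in> borel_measurable (\<Pi>\<^sub>M t\<in>(UNIV :: 'a set). (borel :: real measure))" for s
    by (rule measurable_component_singleton) simp
  have "{f \<in> space (\<Pi>\<^sub>M t\<in>(UNIV :: 'a set). (borel :: real measure)). \<forall>s\<in>S. f s \<le> u s}
      \<in> sets (\<Pi>\<^sub>M t\<in>(UNIV :: 'a set). (borel :: real measure))"
    using \<open>finite S\<close> by measurable
  then show ?thesis by (simp add: space_PiM)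
qed

context max_attraction begin

lemma prob_X_eq:
  assumes A: "A \<in> sets (\<Pi>\<^sub>M t\<in>(UNIV :: 'e set). borel)" and i: "i \<ge> 1"
  shows "prob (X i -` A \<inter> space M) = prob (X 1 -` A \<inter> space M)"
  using arg_cong[OF ident_X[OF i], of "\<lambda>D. measure D A"] A i
  by (simp add: measure_distr measurable_X_process)

lemma prob_all_eq_power:
  assumes A: "A \<in> sets (\<Pi>\<^sub>M t\<in>(UNIV :: 'e set). borel)" and n: "n \<ge> 1"
  shows "prob {\<omega>\<in>space M. \<forall>i\<in>{1..n}. X i \<omega> \<in> A} = prob {\<omega>\<in>space M. X 1 \<omega> \<in> A} ^ n"
proof -
  have "prob {\<omega>\<in>space M. \<forall>i\<in>{1..n}. X i \<omega> \<in> A} = prob (\<Inter>i\<in>{1..n}. X i -` A \<inter> space M)"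
    using n by (intro arg_cong[where f = prob]) auto
  also have "\<dots> = (\<Prod>i\<in>{1..n}. prob (X i -` A \<inter> space M))"
    using A n by (intro indep_varsD[OF indep_X]) auto
  also have "\<dots> = (\<Prod>i\<in>{1..n}. prob (X 1 -` A \<inter> space M))"
    using A by (intro prod.cong refl prob_X_eq) auto
  finally show ?thesis
    by (simp add: vimage_def Int_def conj_commute)
qed

lemma some_exceedance_limit:
  assumes S: "finite S" "S \<noteq> {}" and z: "z > 0"
  shows "(\<lambda>n. real n * prob {\<omega>\<in>space M. \<exists>t\<in>S. level n z t < X 1 \<omega> t})
    \<longlonglongrightarrow> (\<integral>x. (MAX t\<in>S. \<phi> (x - t)) \<partial>lborel) / z"
proof -
  define q where "q n = prob {\<omega>\<in>space M. \<forall>t\<in>S. X 1 \<omega> t \<le> level n z t}" for n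
  have "(\<lambda>n. real n * (1 - q n)) \<longlonglongrightarrow> (\<integral>x. (MAX t\<in>S. \<phi> (x - t)) \<partial>lborel) / z"
  proof (rule tendsto_mult_one_minus_of_power)
    have "prob {\<omega>\<in>space M. \<forall>t\<in>S. (MAX i\<in>{1..n}. X i \<omega> t) \<le> level n z t} = q n ^ n" if "n \<ge> 1" for n
    proof -
      have "(\<forall>t\<in>S. (MAX i\<in>{1..n}. X i \<omega> t) \<le> level n z t) \<longleftrightarrow>
          (\<forall>i\<in>{1..n}. X i \<omega> \<in> {f. \<forall>t\<in>S. f t \<le> level n z t})" for \<omega>
        using that by (subst Max_le_iff) auto
      then show ?thesis
        using prob_all_eq_power[OF non_exceedance_set[OF S(1)] that] by (simp add: q_def)
    qed
    then have "\<forall>\<^sub>F n in sequentially. prob {\<omega>\<in>space M. \<forall>t\<in>S. (MAX i\<in>{1..n}. X i \<omega> t) \<le> level n z t} = q n ^ n"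
      by (intro eventually_sequentiallyI)
    with fidis_convergence[OF assms]
    show "(\<lambda>n. q n ^ n) \<longlonglongrightarrow> exp (- ((\<integral>x. (MAX t\<in>S. \<phi> (x - t)) \<partial>lborel) / z))"
      by (rule Lim_transform_eventually)
  qed (simp add: q_def)
  moreover have "1 - q n = prob {\<omega>\<in>space M. \<exists>t\<in>S. level n z t < X 1 \<omega> t}" for n
    using S(1) unfolding q_def by (subst prob_neg[symmetric]) (auto simp: not_le)
  ultimately show ?thesis by simp
qed

text \<open>Inclusion-exclusion, one site at a time: moving a site from \<open>T\<close> to \<open>S\<close> uses
  \<open>P(A \<inter> B) = P A + P B - P(A \<union> B)\<close>, and \<open>min\<close> and \<open>max\<close> satisfy the corresponding identity.\<close>

lemma joint_exceedance_limit_aux: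
  assumes z: "z > 0" and S: "finite S" and T: "finite T" "T \<noteq> {}"
  shows "(\<lambda>n. real n * prob {\<omega>\<in>space M. (\<forall>s\<in>S. level n z s < X 1 \<omega> s) \<and> (\<exists>t\<in>T. level n z t < X 1 \<omega> t)})
    \<longlonglongrightarrow> (\<integral>x. Min (insert (MAX t\<in>T. \<phi> (x - t)) ((\<lambda>s. \<phi> (x - s)) ` S)) \<partial>lborel) / z"
  using S T
proof (induction S arbitrary: T rule: finite_induct)
  case empty
  then show ?case using some_exceedance_limit[OF empty z] by simp
next
  case (insert u S)
  define G where "G T x = Min (insert (MAX t\<in>T. \<phi> (x - t)) ((\<lambda>s. \<phi> (x - s)) ` S))" for T x
  define P where "P T n = prob {\<omega>\<in>space M. (\<forall>s\<in>S. level n z s < X 1 \<omega> s) \<and> (\<exists>t\<in>T. level n z t < X 1 \<omega> t)}" for T n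
  have int: "integrable lborel (G T)" if "finite T" "T \<noteq> {}" for T
  proof (cases "S = {}")
    case True
    then show ?thesis
      using that unfolding G_def by (simp add: integrable_MAX integrable_\<phi>_shift)
  next
    case False
    then have "G T = (\<lambda>x. min (MAX t\<in>T. \<phi> (x - t)) (MIN s\<in>S. \<phi> (x - s)))"
      using insert.hyps by (simp add: G_def[abs_def])
    then show ?thesis
      using that False insert.hyps(1)
      by (auto intro!: integrable_min integrable_MAX integrable_MIN integrable_\<phi>_shift)
  qed
  have IH: "(\<lambda>n. real n * P T n) \<longlonglongrightarrow> (\<integral>x. G T x \<partial>lborel) / z" if "finite T" "T \<noteq> {}" for T
    using insert.IH[OF that] by (simp add: P_def G_def)
  \<comment> \<open>The induction hypothesis enters for \<open>T\<close>, \<open>{u}\<close> and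
    \<open>insert u T\<close>, hence the generalization over \<open>T\<close>.\<close>
  have "(\<lambda>n. real n * P T n + real n * P {u} n - real n * P (insert u T) n)
      \<longlonglongrightarrow> (\<integral>x. G T x \<partial>lborel) / z + (\<integral>x. G {u} x \<partial>lborel) / z - (\<integral>x. G (insert u T) x \<partial>lborel) / z"
    using insert.prems by (intro tendsto_add tendsto_diff IH) auto
  also have "(\<integral>x. G T x \<partial>lborel) / z + (\<integral>x. G {u} x \<partial>lborel) / z - (\<integral>x. G (insert u T) x \<partial>lborel) / z
      = (\<integral>x. G T x + G {u} x - G (insert u T) x \<partial>lborel) / z"
    using insert.prems int by (simp add: add_divide_distrib diff_divide_distrib)
  \<comment> \<open>With \<open>m\<close> the minimum over \<open>S\<close>, \<open>w\<close> the
    maximum over \<open>T\<close> and \<open>v = \<phi> (x - u)\<close>, the identity is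
    \<open>min w m + min v m - min (max v w) m = min w (min v m)\<close>.\<close>
  also have "(\<lambda>x. G T x + G {u} x - G (insert u T) x)
      = (\<lambda>x. Min (insert (MAX t\<in>T. \<phi> (x - t)) ((\<lambda>s. \<phi> (x - s)) ` insert u S)))"
  proof
    fix x
    have max: "(MAX t\<in>insert u T. \<phi> (x - t)) = max (\<phi> (x - u)) (MAX t\<in>T. \<phi> (x - t))"
      using insert.prems by simp
    show "G T x + G {u} x - G (insert u T) x
      = Min (insert (MAX t\<in>T. \<phi> (x - t)) ((\<lambda>s. \<phi> (x - s)) ` insert u S))"
    proof (cases "S = {}")
      case True
      then show ?thesis unfolding G_def max by (auto simp: min_def max_def)
    next
      case False
      define m where "m = (MIN s\<in>S. \<phi> (x - s))"
      have G_eq: "G T' x = min (MAX t\<in>T'. \<phi> (x - t)) m" for T'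
        using False insert.hyps(1) by (simp add: G_def m_def)
      have Min_eq: "Min (insert w ((\<lambda>s. \<phi> (x - s)) ` insert u S)) = min w (min (\<phi> (x - u)) m)" for w
        using False insert.hyps(1) by (simp add: m_def)
      show ?thesis
        unfolding G_eq Min_eq max by (auto simp: min_def max_def)
    qed
  qed
  also have "(\<lambda>n. real n * P T n + real n * P {u} n - real n * P (insert u T) n) =
    (\<lambda>n. real n * prob {\<omega>\<in>space M. (\<forall>s\<in>insert u S. level n z s < X 1 \<omega> s) \<and> (\<exists>t\<in>T. level n z t < X 1 \<omega> t)})"
  proof
    fix n
    let ?E = "\<lambda>T. {\<omega>\<in>space M. (\<forall>s\<in>S. level n z s < X 1 \<omega> s) \<and> (\<exists>t\<in>T. level n z t < X 1 \<omega> t)}"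
    have meas: "?E T \<in> events" if "finite T" for T
      using that insert.hyps(1) by measurable
    have "P (insert u T) n = prob (?E T \<union> ?E {u})"
      unfolding P_def by (intro arg_cong[where f = prob]) auto
    also have "\<dots> = P T n + P {u} n - prob (?E T \<inter> ?E {u})"
      unfolding P_def
      by (rule measure_Un3) (use meas[OF insert.prems(1)] meas[of "{u}"] in \<open>simp_all add: fmeasurable_eq_sets\<close>)
    also have "?E T \<inter> ?E {u} = {\<omega>\<in>space M. (\<forall>s\<in>insert u S. level n z s < X 1 \<omega> s) \<and> (\<exists>t\<in>T. level n z t < X 1 \<omega> t)}"
      by auto
    finally have P_insert: "P (insert u T) n = P T n + P {u} n -
      prob {\<omega>\<in>space M. (\<forall>s\<in>insert u S. level n z s < X 1 \<omega> s) \<and> (\<exists>t\<in>T. level n z t < X 1 \<omega> t)}" .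
    show "real n * P T n + real n * P {u} n - real n * P (insert u T) n =
      real n * prob {\<omega>\<in>space M. (\<forall>s\<in>insert u S. level n z s < X 1 \<omega> s) \<and> (\<exists>t\<in>T. level n z t < X 1 \<omega> t)}"
      unfolding P_insert by (simp add: algebra_simps)
  qed
  finally show ?case .
qed

lemma joint_exceedance_limit:
  assumes z: "z > 0" and S: "finite S" "S \<noteq> {}"
  shows "(\<lambda>n. real n * prob {\<omega>\<in>space M. \<forall>s\<in>S. level n z s < X 1 \<omega> s})
    \<longlonglongrightarrow> (\<integral>x. (MIN s\<in>S. \<phi> (x - s)) \<partial>lborel) / z"
proof -
  obtain t where "t \<in> S" using S(2) by blast
  \<comment> \<open>Taking \<open>t\<close> from \<open>S\<close> makes both the clause about
    \<open>T = {t}\<close> and the additional entry of the minimum redundant.\<close>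
  then have "(\<lambda>s. \<phi> (x - s)) ` S = insert (\<phi> (x - t)) ((\<lambda>s. \<phi> (x - s)) ` S)" for x by auto
  moreover have "(\<forall>s\<in>S. level n z s < X 1 \<omega> s) \<longleftrightarrow>
      (\<forall>s\<in>S. level n z s < X 1 \<omega> s) \<and> (\<exists>t\<in>{t}. level n z t < X 1 \<omega> t)" for n \<omega>
    using \<open>t \<in> S\<close> by auto
  ultimately show ?thesis
    using joint_exceedance_limit_aux[OF z S(1), of "{t}"] by simp
qed

end

section \<open>Consistency of the empirical tail dependence coefficient\<close>

lemma R_hat_eq_card:
  assumes "k \<ge> 1"
  shows "R_hat X n k S \<omega> =
    real (card {i\<in>{1..n}. \<forall>s\<in>S. card {l\<in>{1..n}. X i \<omega> s < X l \<omega> s} < min k n}) / real k"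
proof -
  have "(\<forall>s\<in>S. X i \<omega> s \<ge> order_stat (\<lambda>l. X l \<omega> s) (n - k + 1) n) \<longleftrightarrow>
      (\<forall>s\<in>S. card {l\<in>{1..n}. X i \<omega> s < X l \<omega> s} < min k n)" if "i \<in> {1..n}" for i
    using that assms by (intro ball_cong refl order_stat_le_iff) auto
  then have "(\<Sum>i=1..n. of_bool (\<forall>s\<in>S. X i \<omega> s \<ge> order_stat (\<lambda>l. X l \<omega> s) (n - k + 1) n) :: real)
      = (\<Sum>i=1..n. of_bool (\<forall>s\<in>S. card {l\<in>{1..n}. X i \<omega> s < X l \<omega> s} < min k n))"
    by (intro sum.cong refl arg_cong[where f = of_bool])
  also have "\<dots> = real (card {i\<in>{1..n}. \<forall>s\<in>S. card {l\<in>{1..n}. X i \<omega> s < X l \<omega> s} < min k n})"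
    by (simp add: of_bool_def sum.If_cases Int_def)
  finally show ?thesis
    by (simp add: R_hat_def)
qed

text \<open>An observation above \<open>u s\<close> has at most as many observations above it as
  \<open>u s\<close> itself, hence fewer than \<open>k\<close>; so every joint exceedance of
  \<open>u\<close> is counted.\<close>

lemma R_hat_ge:
  assumes k: "k \<ge> 1" and lt: "\<And>s. s \<in> S \<Longrightarrow> card {l\<in>{1..n}. u s < X l \<omega> s} < k"
  shows "real (card {i\<in>{1..n}. \<forall>s\<in>S. u s < X i \<omega> s}) / real k \<le> R_hat X n k S \<omega>"
  unfolding R_hat_eq_card[OF k]
proof (intro divide_right_mono of_nat_mono card_mono subsetI)
  fix i assume "i \<in> {i\<in>{1..n}. \<forall>s\<in>S. u s < X i \<omega> s}"
  then have i: "i \<in> {1..n}" "\<And>s. s \<in> S \<Longrightarrow> u s < X i \<omega> s" by auto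
  have "card {l\<in>{1..n}. X i \<omega> s < X l \<omega> s} < min k n" if s: "s \<in> S" for s
  proof -
    have "card {l\<in>{1..n}. X i \<omega> s < X l \<omega> s} \<le> card {l\<in>{1..n}. u s < X l \<omega> s}"
      by (rule card_mono) (use i(2)[OF s] in auto)
    \<comment> \<open>The observation \<open>i\<close> is not above itself, which yields the bound
      by \<open>n\<close> in \<open>min k n\<close>.\<close>
    moreover have "card {l\<in>{1..n}. X i \<omega> s < X l \<omega> s} < card {1..n}"
      by (rule psubset_card_mono) (use i(1) in blast)+
    ultimately show ?thesis using lt[OF s] by simp
  qed
  then show "i \<in> {i\<in>{1..n}. \<forall>s\<in>S. card {l\<in>{1..n}. X i \<omega> s < X l \<omega> s} < min k n}"
    using i(1) by simp
qed simp_all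

text \<open>An observation not above \<open>u s\<close> has at least as many observations above it
  as \<open>u s\<close>, hence more than \<open>k\<close>, and is not counted.\<close>

lemma R_hat_le:
  assumes k: "k \<ge> 1" and gt: "\<And>s. s \<in> S \<Longrightarrow> card {l\<in>{1..n}. u s < X l \<omega> s} > k"
  shows "R_hat X n k S \<omega> \<le> real (card {i\<in>{1..n}. \<forall>s\<in>S. u s < X i \<omega> s}) / real k"
  unfolding R_hat_eq_card[OF k]
proof (intro divide_right_mono of_nat_mono card_mono subsetI)
  fix i assume "i \<in> {i\<in>{1..n}. \<forall>s\<in>S. card {l\<in>{1..n}. X i \<omega> s < X l \<omega> s} < min k n}"
  then have i: "i \<in> {1..n}" "\<And>s. s \<in> S \<Longrightarrow> card {l\<in>{1..n}. X i \<omega> s < X l \<omega> s} < k" by auto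
  have "u s < X i \<omega> s" if s: "s \<in> S" for s
  proof (rule ccontr)
    assume "\<not> u s < X i \<omega> s"
    then have "card {l\<in>{1..n}. u s < X l \<omega> s} \<le> card {l\<in>{1..n}. X i \<omega> s < X l \<omega> s}"
      by (intro card_mono) auto
    with gt[OF s] i(2)[OF s] show False by simp
  qed
  then show "i \<in> {i\<in>{1..n}. \<forall>s\<in>S. u s < X i \<omega> s}"
    using i(1) by simp
qed simp_all

text \<open>Thresholds are indexed by natural numbers, so \<open>n / k n\<close> is replaced by the
  integer quotient; the second claim says that the rounding is harmless in the limit.\<close>

lemma filterlim_div_at_top:
  fixes k :: "nat \<Rightarrow> nat"
  assumes "filterlim k at_top sequentially" "(\<lambda>n. real (k n) / real n) \<longlonglongrightarrow> 0"
  shows "filterlim (\<lambda>n. n div k n) at_top sequentially"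
    and "(\<lambda>n. real n / (real (k n) * real (n div k n))) \<longlonglongrightarrow> 1"
proof -
  have k1: "\<forall>\<^sub>F n in sequentially. k n \<ge> 1"
    using assms(1) by (simp add: filterlim_at_top)
  have m: "\<forall>\<^sub>F n in sequentially. m \<le> n div k n" for m
  proof -
    have "\<forall>\<^sub>F n in sequentially. real (k n) / real n < 1 / (real m + 1)"
      by (rule order_tendstoD(2)[OF assms(2)]) simp
    then show ?thesis using k1 eventually_gt_at_top[of 0]
    proof eventually_elim
      case (elim n)
      then have "real (m * k n) \<le> real n"
        by (simp add: field_simps)
      then have "m * k n \<le> n" by linarith
      then show ?case using elim by (simp add: less_eq_div_iff_mult_less_eq)
    qed
  qed
  then show *: "filterlim (\<lambda>n. n div k n) at_top sequentially"
    by (simp add: filterlim_at_top)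
  have "(\<lambda>n. 1 + 1 / real (n div k n)) \<longlonglongrightarrow> 1 + 0"
    by (intro tendsto_add tendsto_const filterlim_compose[OF lim_1_over_n *])
  then have up: "(\<lambda>n. 1 + 1 / real (n div k n)) \<longlonglongrightarrow> 1" by simp
  show "(\<lambda>n. real n / (real (k n) * real (n div k n))) \<longlonglongrightarrow> 1"
  proof (rule tendsto_sandwich[OF _ _ tendsto_const up])
    show "\<forall>\<^sub>F n in sequentially. 1 \<le> real n / (real (k n) * real (n div k n))"
      using k1 m[of 1]
    proof eventually_elim
      case (elim n)
      have "real (k n * (n div k n)) \<le> real n"
        by (intro of_nat_mono) (simp add: mult.commute)
      with elim show ?case by (simp add: pos_le_divide_eq)
    qed
    show "\<forall>\<^sub>F n in sequentially. real n / (real (k n) * real (n div k n)) \<le> 1 + 1 / real (n div k n)"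
      using k1 m[of 1]
    proof eventually_elim
      case (elim n)
      have "n \<le> k n * (n div k n + 1)"
        using elim dividend_less_div_times[of "k n" n] by (simp add: algebra_simps)
      then have "real n \<le> real (k n * (n div k n + 1))" by (simp only: of_nat_le_iff)
      also have "\<dots> = (1 + 1 / real (n div k n)) * (real (k n) * real (n div k n))"
        using elim by (simp add: field_simps)
      finally show ?case using elim by (subst pos_divide_le_eq) auto
    qed
  qed
qed

lemma measurable_card_Collect:
  assumes "finite I" "\<And>i. i \<in> I \<Longrightarrow> Measurable.pred M (P i)"
  shows "(\<lambda>\<omega>. card {i\<in>I. P i \<omega>}) \<in> M \<rightarrow>\<^sub>M count_space UNIV"
proof -
  have "card {i\<in>I. P i \<omega>} = (\<Sum>i\<in>I. of_bool (P i \<omega>))" for \<omega>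
    using assms(1) by (simp add: of_bool_def sum.If_cases Int_def)
  moreover have "(\<lambda>\<omega>. \<Sum>i\<in>I. of_bool (P i \<omega>) :: nat) \<in> M \<rightarrow>\<^sub>M count_space UNIV"
  proof (rule measurable_sum_nat)
    fix i assume "i \<in> I"
    then have [measurable]: "Measurable.pred M (P i)" by (rule assms)
    show "(\<lambda>\<omega>. of_bool (P i \<omega>) :: nat) \<in> M \<rightarrow>\<^sub>M count_space UNIV"
      unfolding of_bool_def by measurable
  qed
  ultimately show ?thesis by simp
qed

section \<open>Concentration of the counts\<close>

context max_attraction begin

text \<open>Measurability into the discrete sigma-algebra is stronger than Borel measurability; it
  holds because the estimator is a function of a natural number valued count.\<close>

lemma measurable_R_hat:
  assumes "finite S"
  shows "R_hat X n k S \<in> M \<rightarrow>\<^sub>M count_space UNIV"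
proof (cases "k = 0")
  \<comment> \<open>The value \<open>k n = 0\<close> may occur for small \<open>n\<close>; with the
    convention \<open>1 / 0 = 0\<close> the estimator is then constant.\<close>
  case True
  then have "R_hat X n k S = (\<lambda>_. 0)" by (simp add: R_hat_def[abs_def])
  then show ?thesis by simp
next
  case False
  let ?N = "\<lambda>\<omega>. card {i\<in>{1..n}. \<forall>s\<in>S. card {l\<in>{1..n}. X i \<omega> s < X l \<omega> s} < min k n}"
  have "Measurable.pred M (\<lambda>\<omega>. \<forall>s\<in>S. card {l\<in>{1..n}. X i \<omega> s < X l \<omega> s} < min k n)"
    if i: "i \<in> {1..n}" for i
  proof (rule pred_intros_finite(3)[OF assms])
    fix s
    have [measurable]: "(\<lambda>\<omega>. card {l\<in>{1..n}. X i \<omega> s < X l \<omega> s}) \<in> M \<rightarrow>\<^sub>M count_space UNIV"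
    proof (rule measurable_card_Collect)
      fix l assume "l \<in> {1..n}"
      then have [measurable]: "(\<lambda>\<omega>. X l \<omega> s) \<in> borel_measurable M" "(\<lambda>\<omega>. X i \<omega> s) \<in> borel_measurable M"
        using i by (simp_all add: measurable_X)
      show "Measurable.pred M (\<lambda>\<omega>. X i \<omega> s < X l \<omega> s)" by measurable
    qed simp
    show "Measurable.pred M (\<lambda>\<omega>. card {l\<in>{1..n}. X i \<omega> s < X l \<omega> s} < min k n)" by measurable
  qed
  then have "?N \<in> M \<rightarrow>\<^sub>M count_space UNIV"
    by (rule measurable_card_Collect[OF finite_atLeastAtMost])
  then have "(\<lambda>\<omega>. real (?N \<omega>) / real k) \<in> M \<rightarrow>\<^sub>M count_space UNIV"
    by (rule measurable_compose) simp
  moreover have "R_hat X n k S = (\<lambda>\<omega>. real (?N \<omega>) / real k)"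
    using False by (intro ext R_hat_eq_card) simp
  ultimately show ?thesis by (simp only:)
qed

text \<open>The count has mean about \<open>k n * L\<close> and a variance at most its mean, so
  after division by \<open>k n\<close> the variance is of order \<open>1 / k n\<close>. That
  \<open>k n / n\<close> vanishes makes the index \<open>n div k n\<close> of the threshold tend to
  infinity.\<close>

lemma prob_count_deviation:
  assumes S: "finite S" "S \<noteq> {}" and z: "z > 0" and \<epsilon>: "\<epsilon> > 0"
    and k: "filterlim k at_top sequentially" "(\<lambda>n. real (k n) / real n) \<longlonglongrightarrow> 0"
  defines "L \<equiv> (\<integral>x. (MIN s\<in>S. \<phi> (x - s)) \<partial>lborel) / z"
  shows "(\<lambda>n. prob {\<omega>\<in>space M. \<epsilon> \<le>
      \<bar>real (card {i\<in>{1..n}. \<forall>s\<in>S. level (n div k n) z s < X i \<omega> s}) / real (k n) - L\<bar>}) \<longlonglongrightarrow> 0"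
proof -
  define A where "A n = {f. \<forall>s\<in>S. level (n div k n) z s < f s}" for n
  define p where "p n = prob {\<omega>\<in>space M. X 1 \<omega> \<in> A n}" for n
  define C where "C n \<omega> = real (card {i\<in>{1..n}. X i \<omega> \<in> A n})" for n \<omega>
  have A: "A n \<in> sets (\<Pi>\<^sub>M t\<in>(UNIV :: 'e set). borel)" for n
    unfolding A_def using S(1) by (rule exceedance_set)
  have pk: "(\<lambda>n. real n / real (k n) * p n) \<longlonglongrightarrow> L"
  proof -
    have "(\<lambda>n. real (n div k n) * p n) \<longlonglongrightarrow> L"
      using filterlim_compose[OF joint_exceedance_limit[OF z S] filterlim_div_at_top(1)[OF k]]
      by (simp add: p_def A_def L_def)
    with filterlim_div_at_top(2)[OF k]
    have "(\<lambda>n. real n / (real (k n) * real (n div k n)) * (real (n div k n) * p n)) \<longlonglongrightarrow> 1 * L"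
      by (rule tendsto_mult)
    moreover have "\<forall>\<^sub>F n in sequentially. n div k n \<ge> 1"
      using filterlim_div_at_top(1)[OF k] by (simp add: filterlim_at_top)
    then have "\<forall>\<^sub>F n in sequentially. real n / (real (k n) * real (n div k n)) * (real (n div k n) * p n)
        = real n / real (k n) * p n"
      by eventually_elim simp
    ultimately show ?thesis by (simp add: tendsto_cong)
  qed
  have "\<forall>\<^sub>F n in sequentially. \<bar>real n / real (k n) * p n - L\<bar> < \<epsilon> / 2"
    using tendstoD[OF pk, of "\<epsilon> / 2"] \<epsilon> by (simp add: dist_real_def)
  moreover have "\<forall>\<^sub>F n in sequentially. k n \<ge> 1"
    using k(1) by (simp add: filterlim_at_top)
  ultimately have bound: "\<forall>\<^sub>F n in sequentially. prob {\<omega>\<in>space M. \<epsilon> \<le> \<bar>C n \<omega> / real (k n) - L\<bar>}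
      \<le> (real n / real (k n) * p n) * (1 / real (k n)) * (4 / \<epsilon>\<^sup>2)"
  proof eventually_elim
    case (elim n)
    have kn: "real (k n) > 0" using elim(2) by simp
    let ?E = "\<lambda>i. X i -` A n \<inter> space M"
    have E: "?E i \<in> events" "prob (?E i) = p n" if "i \<in> {1..n}" for i
    proof -
      show "?E i \<in> events"
        by (rule measurable_sets[OF measurable_X_process A]) (use that in simp)
      show "prob (?E i) = p n"
        using that prob_X_eq[OF A, of i n] by (simp add: p_def vimage_def Int_def conj_commute)
    qed
    have pair: "prob (?E i \<inter> ?E j) = (p n)\<^sup>2" if "i \<in> {1..n}" "j \<in> {1..n}" "i \<noteq> j" for i j
    proof -
      have "prob (\<Inter>l\<in>{i, j}. X l -` A n \<inter> space M) = (\<Prod>l\<in>{i, j}. prob (X l -` A n \<inter> space M))"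
        by (rule indep_varsD[OF indep_X]) (use that A in auto)
      then show ?thesis using that E by (simp add: power2_eq_square)
    qed
    have C_eq: "C n \<omega> = real (card {i\<in>{1..n}. \<omega> \<in> ?E i})" if "\<omega> \<in> space M" for \<omega>
      using that by (simp add: C_def)
    have meas: "{\<omega>\<in>space M. c \<le> \<bar>C n \<omega> - real n * p n\<bar>} \<in> events" for c
    proof -
      have "Measurable.pred M (\<lambda>\<omega>. X i \<omega> \<in> A n)" if "i \<in> {1..n}" for i
        using E(1)[OF that] by (simp add: pred_def vimage_def Int_def conj_commute)
      then have "(\<lambda>\<omega>. card {i\<in>{1..n}. X i \<omega> \<in> A n}) \<in> M \<rightarrow>\<^sub>M count_space UNIV"
        by (rule measurable_card_Collect[OF finite_atLeastAtMost])
      then have [measurable]: "C n \<in> borel_measurable M"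
        unfolding C_def[abs_def] by measurable
      show ?thesis by measurable
    qed
    have "prob {\<omega>\<in>space M. \<epsilon> \<le> \<bar>C n \<omega> / real (k n) - L\<bar>}
        \<le> prob {\<omega>\<in>space M. real (k n) * (\<epsilon> / 2) \<le> \<bar>C n \<omega> - real n * p n\<bar>}"
    proof (intro finite_measure_mono subsetI meas)
      fix \<omega> assume "\<omega> \<in> {\<omega>\<in>space M. \<epsilon> \<le> \<bar>C n \<omega> / real (k n) - L\<bar>}"
      then have \<omega>: "\<omega> \<in> space M" "\<epsilon> \<le> \<bar>C n \<omega> / real (k n) - L\<bar>"
        by auto
      \<comment> \<open>The scaled mean is already within \<open>\<epsilon> / 2\<close> of
        \<open>L\<close>, so a deviation \<open>\<epsilon>\<close> from \<open>L\<close> leaves at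
        least \<open>\<epsilon> / 2\<close> to the random fluctuation.\<close>
      have "\<epsilon> / 2 \<le> \<bar>x - y\<bar>" if "\<epsilon> \<le> \<bar>x - L\<bar>" "\<bar>y - L\<bar> < \<epsilon> / 2" for x y
        using that by (simp add: abs_if split: if_splits)
      from this[OF \<omega>(2) elim(1)] have "\<epsilon> / 2 \<le> \<bar>C n \<omega> / real (k n) - real n / real (k n) * p n\<bar>" .
      moreover have "\<bar>C n \<omega> / real (k n) - real n / real (k n) * p n\<bar> = \<bar>C n \<omega> - real n * p n\<bar> / real (k n)"
        using kn by (simp add: diff_divide_distrib[symmetric] abs_divide)
      ultimately show "\<omega> \<in> {\<omega>\<in>space M. real (k n) * (\<epsilon> / 2) \<le> \<bar>C n \<omega> - real n * p n\<bar>}"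
        using kn \<omega>(1) by (simp add: pos_le_divide_eq mult.commute)
    qed
    also have "\<dots> = prob {\<omega>\<in>space M. real (k n) * (\<epsilon> / 2) \<le> \<bar>real (card {i\<in>{1..n}. \<omega> \<in> ?E i}) - real (card {1..n}) * p n\<bar>}"
      using C_eq by (intro arg_cong[where f = prob]) auto
    also have "\<dots> \<le> real (card {1..n}) * p n / (real (k n) * (\<epsilon> / 2))\<^sup>2"
      by (rule prob_card_deviation_le) (use E pair kn \<epsilon> in auto)
    also have "\<dots> = (real n / real (k n) * p n) * (1 / real (k n)) * (4 / \<epsilon>\<^sup>2)"
      using kn \<epsilon> by (simp add: field_simps power2_eq_square)
    finally show ?case .
  qed
  have "(\<lambda>n. 1 / real (k n)) \<longlonglongrightarrow> 0"
    by (rule filterlim_compose[OF lim_1_over_n k(1)])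
  then have "(\<lambda>n. (real n / real (k n) * p n) * (1 / real (k n)) * (4 / \<epsilon>\<^sup>2)) \<longlonglongrightarrow> L * 0 * (4 / \<epsilon>\<^sup>2)"
    by (intro tendsto_mult pk tendsto_const)
  then have "(\<lambda>n. prob {\<omega>\<in>space M. \<epsilon> \<le> \<bar>C n \<omega> / real (k n) - L\<bar>}) \<longlonglongrightarrow> 0"
    by (intro tendsto_sandwich[OF _ bound tendsto_const]) auto
  then show ?thesis by (simp add: C_def A_def)
qed

lemma conv_in_prob_R_hat:
  assumes S: "finite S" "S \<noteq> {}"
    and k: "filterlim k at_top sequentially" "(\<lambda>n. real (k n) / real n) \<longlonglongrightarrow> 0"
  shows "conv_in_prob M (\<lambda>n. R_hat X n (k n) S) (\<integral>x. (MIN s\<in>S. \<phi> (x - s)) \<partial>lborel)"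
  unfolding conv_in_prob_def
proof (intro conjI allI impI)
  have R [measurable]: "R_hat X n (k n) S \<in> borel_measurable M" for n
    using measurable_compose[OF measurable_R_hat[OF S(1)], of "\<lambda>x. x" borel] by simp
  then show "R_hat X n (k n) S \<in> borel_measurable M" for n .
  define L where "L = (\<integral>x. (MIN s\<in>S. \<phi> (x - s)) \<partial>lborel)"
  fix \<epsilon> :: real assume \<epsilon>: "\<epsilon> > 0"
  \<comment> \<open>At \<open>z = 1 - \<delta>\<close> and \<open>z = 1 + \<delta>\<close> the
    scaled joint counts tend to \<open>L / (1 - \<delta>)\<close> and
    \<open>L / (1 + \<delta>)\<close>. Half of \<open>\<epsilon>\<close> pays for this distortion,
    the other half for randomness.\<close>
  have lims: "((\<lambda>\<delta>. L / (1 - \<delta>)) \<longlongrightarrow> L / (1 - 0)) (at_right 0)" "((\<lambda>\<delta>. L / (1 + \<delta>)) \<longlongrightarrow> L / (1 + 0)) (at_right 0)"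
    by (intro tendsto_intros; simp)+
  have "\<forall>\<^sub>F \<delta> in at_right 0. dist (L / (1 - \<delta>)) (L / (1 - 0)) < \<epsilon> / 2"
    "\<forall>\<^sub>F \<delta> in at_right 0. dist (L / (1 + \<delta>)) (L / (1 + 0)) < \<epsilon> / 2"
    using tendstoD[OF lims(1), of "\<epsilon> / 2"] tendstoD[OF lims(2), of "\<epsilon> / 2"] \<epsilon> by simp_all
  moreover have "\<forall>\<^sub>F \<delta> in at_right (0::real). \<delta> \<in> {0<..<1}"
    by (rule eventually_at_rightI[of 0 1]) auto
  ultimately have "\<forall>\<^sub>F \<delta> in at_right 0. \<bar>L / (1 - \<delta>) - L\<bar> < \<epsilon> / 2 \<and> \<bar>L / (1 + \<delta>) - L\<bar> < \<epsilon> / 2 \<and> 0 < \<delta> \<and> \<delta> < 1"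
    by eventually_elim (simp add: dist_real_def)
  then obtain \<delta> where \<delta>: "\<bar>L / (1 - \<delta>) - L\<bar> < \<epsilon> / 2" "\<bar>L / (1 + \<delta>) - L\<bar> < \<epsilon> / 2" "0 < \<delta>" "\<delta> < 1"
    using eventually_happens[of _ "at_right (0::real)"] by auto
  define c where "c n z T \<omega> = real (card {i\<in>{1..n}. \<forall>s\<in>T. level (n div k n) z s < X i \<omega> s}) / real (k n)" for n z T \<omega>
  define B where "B n e z T = {\<omega>\<in>space M. e \<le> \<bar>c n z T \<omega> - (\<integral>x. (MIN s\<in>T. \<phi> (x - s)) \<partial>lborel) / z\<bar>}" for n e z T
  have B_lim: "(\<lambda>n. prob (B n e z T)) \<longlonglongrightarrow> 0" if "finite T" "T \<noteq> {}" "z > 0" "e > 0" for T z e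
    unfolding B_def c_def by (rule prob_count_deviation[OF that(1-4) k])
  have B_meas [measurable]: "B n e z T \<in> events" if T: "finite T" for n e z T
  proof -
    have "(\<lambda>\<omega>. card {i\<in>{1..n}. \<forall>s\<in>T. level (n div k n) z s < X i \<omega> s}) \<in> M \<rightarrow>\<^sub>M count_space UNIV"
    proof (rule measurable_card_Collect)
      fix i assume "i \<in> {1..n}"
      then have [measurable]: "(\<lambda>\<omega>. X i \<omega> s) \<in> borel_measurable M" for s by (auto intro!: measurable_X)
      show "Measurable.pred M (\<lambda>\<omega>. \<forall>s\<in>T. level (n div k n) z s < X i \<omega> s)"
        using T by measurable
    qed simp
    then have [measurable]: "c n z T \<in> borel_measurable M"
      unfolding c_def[abs_def] by measurable
    show ?thesis unfolding B_def by measurable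
  qed
  \<comment> \<open>On \<open>U n\<close> some marginal count goes astray, and its thresholds may
    fail to enclose the order statistic; on \<open>V n\<close> a joint count does.\<close>
  define U where "U n = (\<Union>s\<in>S. B n (\<delta> / 2) (1 - \<delta>) {s} \<union> B n (\<delta> / 2) (1 + \<delta>) {s})" for n
  define V where "V n = B n (\<epsilon> / 2) (1 - \<delta>) S \<union> B n (\<epsilon> / 2) (1 + \<delta>) S" for n
  have mean: "(\<integral>x. (MIN s\<in>{s}. \<phi> (x - s)) \<partial>lborel) = 1" for s
    using integral_\<phi>_shift[of s] by simp
  have key: "{\<omega>\<in>space M. \<epsilon> < \<bar>R_hat X n (k n) S \<omega> - L\<bar>} \<subseteq> U n \<union> V n" if kn: "k n \<ge> 1" for n
  proof
    fix \<omega> assume \<omega>: "\<omega> \<in> {\<omega>\<in>space M. \<epsilon> < \<bar>R_hat X n (k n) S \<omega> - L\<bar>}"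
    show "\<omega> \<in> U n \<union> V n"
    proof (rule ccontr)
      assume "\<omega> \<notin> U n \<union> V n"
      then have U: "\<bar>c n (1 - \<delta>) {s} \<omega> - 1 / (1 - \<delta>)\<bar> < \<delta> / 2" "\<bar>c n (1 + \<delta>) {s} \<omega> - 1 / (1 + \<delta>)\<bar> < \<delta> / 2"
        if "s \<in> S" for s
        using that \<omega> unfolding U_def B_def mean by (auto simp: not_le)
      have V: "\<bar>c n (1 - \<delta>) S \<omega> - L / (1 - \<delta>)\<bar> < \<epsilon> / 2" "\<bar>c n (1 + \<delta>) S \<omega> - L / (1 + \<delta>)\<bar> < \<epsilon> / 2"
        using \<open>\<omega> \<notin> U n \<union> V n\<close> \<omega> unfolding V_def B_def L_def by (auto simp: not_le)
      \<comment> \<open>These bounds, valid for \<open>0 < \<delta> < 1\<close>, explain the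
        tolerance \<open>\<delta> / 2\<close> in \<open>U n\<close>: outside it the scaled marginal
        counts stay strictly on their sides of 1.\<close>
      have "1 / (1 - \<delta>) \<ge> 1 + \<delta> / 2" "1 / (1 + \<delta>) \<le> 1 - \<delta> / 2"
        using \<delta>(3,4) mult_left_mono[of \<delta> 1 \<delta>] by (simp_all add: field_simps)
      then have "c n (1 - \<delta>) {s} \<omega> > 1" "c n (1 + \<delta>) {s} \<omega> < 1" if "s \<in> S" for s
        using U[OF that] by (simp_all only: abs_less_iff) linarith+
      then have "card {i\<in>{1..n}. level (n div k n) (1 - \<delta>) s < X i \<omega> s} > k n"
        "card {i\<in>{1..n}. level (n div k n) (1 + \<delta>) s < X i \<omega> s} < k n" if "s \<in> S" for s
        using that kn by (simp_all add: c_def)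
      then have "R_hat X n (k n) S \<omega> \<le> c n (1 - \<delta>) S \<omega>" "c n (1 + \<delta>) S \<omega> \<le> R_hat X n (k n) S \<omega>"
        unfolding c_def using kn by (intro R_hat_le R_hat_ge; simp)+
      with V \<delta>(1,2) have "\<bar>R_hat X n (k n) S \<omega> - L\<bar> \<le> \<epsilon>"
        by (simp only: abs_less_iff abs_le_iff) linarith
      with \<omega> show False by simp
    qed
  qed
  have "(\<lambda>n. (\<Sum>s\<in>S. prob (B n (\<delta> / 2) (1 - \<delta>) {s}) + prob (B n (\<delta> / 2) (1 + \<delta>) {s})) +
      (prob (B n (\<epsilon> / 2) (1 - \<delta>) S) + prob (B n (\<epsilon> / 2) (1 + \<delta>) S))) \<longlonglongrightarrow> (\<Sum>s\<in>S. 0 + 0) + (0 + 0)"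
    using \<delta>(3,4) \<epsilon> S by (intro tendsto_add tendsto_sum B_lim) auto
  then have "(\<lambda>n. (\<Sum>s\<in>S. prob (B n (\<delta> / 2) (1 - \<delta>) {s}) + prob (B n (\<delta> / 2) (1 + \<delta>) {s})) +
      (prob (B n (\<epsilon> / 2) (1 - \<delta>) S) + prob (B n (\<epsilon> / 2) (1 + \<delta>) S))) \<longlonglongrightarrow> 0"
    by simp
  moreover have "\<forall>\<^sub>F n in sequentially. prob {\<omega>\<in>space M. \<epsilon> < \<bar>R_hat X n (k n) S \<omega> - L\<bar>} \<le>
      (\<Sum>s\<in>S. prob (B n (\<delta> / 2) (1 - \<delta>) {s}) + prob (B n (\<delta> / 2) (1 + \<delta>) {s})) +
      (prob (B n (\<epsilon> / 2) (1 - \<delta>) S) + prob (B n (\<epsilon> / 2) (1 + \<delta>) S))"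
  proof -
    have "\<forall>\<^sub>F n in sequentially. k n \<ge> 1"
      using k(1) by (simp add: filterlim_at_top)
    then show ?thesis
    proof eventually_elim
      case (elim n)
      have [measurable]: "U n \<in> events" "V n \<in> events"
        unfolding U_def V_def using S(1) by (auto intro!: sets.finite_UN)
      have "prob {\<omega>\<in>space M. \<epsilon> < \<bar>R_hat X n (k n) S \<omega> - L\<bar>} \<le> prob (U n \<union> V n)"
        by (intro finite_measure_mono key elim) measurable
      also have "\<dots> \<le> prob (U n) + prob (V n)"
        by (rule measure_Un_le) measurable
      also have "prob (U n) \<le> (\<Sum>s\<in>S. prob (B n (\<delta> / 2) (1 - \<delta>) {s} \<union> B n (\<delta> / 2) (1 + \<delta>) {s}))"
        unfolding U_def using S(1) by (intro finite_measure_subadditive_finite) auto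
      also have "\<dots> \<le> (\<Sum>s\<in>S. prob (B n (\<delta> / 2) (1 - \<delta>) {s}) + prob (B n (\<delta> / 2) (1 + \<delta>) {s}))"
        by (intro sum_mono measure_Un_le B_meas) auto
      also have "prob (V n) \<le> prob (B n (\<epsilon> / 2) (1 - \<delta>) S) + prob (B n (\<epsilon> / 2) (1 + \<delta>) S)"
        unfolding V_def using S(1) by (intro measure_Un_le B_meas)
      finally show ?case by simp
    qed
  qed
  ultimately have "(\<lambda>n. prob {\<omega>\<in>space M. \<epsilon> < \<bar>R_hat X n (k n) S \<omega> - L\<bar>}) \<longlonglongrightarrow> 0"
    by (intro tendsto_sandwich[OF always_eventually[OF allI[OF measure_nonneg]] _ tendsto_const])
  then show "(\<lambda>n. prob {\<omega>\<in>space M. \<epsilon> < \<bar>R_hat X n (k n) S \<omega> - (\<integral>x. (MIN s\<in>S. \<phi> (x - s)) \<partial>lborel)\<bar>}) \<longlonglongrightarrow> 0"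
    unfolding L_def .
qed

text \<open>Measurability is no obstacle for an arbitrary \<open>g\<close>: \<open>R_hat\<close> takes finitely many values.\<close>

lemma conv_in_prob_fun_R_hat:
  assumes S: "finite S" "S \<noteq> {}"
    and k: "filterlim k at_top sequentially" "(\<lambda>n. real (k n) / real n) \<longlonglongrightarrow> 0"
    and g: "isCont g (\<integral>x. (MIN s\<in>S. \<phi> (x - s)) \<partial>lborel)"
  shows "conv_in_prob M (\<lambda>n \<omega>. g (R_hat X n (k n) S \<omega>)) (g (\<integral>x. (MIN s\<in>S. \<phi> (x - s)) \<partial>lborel))"
proof (rule conv_in_prob_isCont[OF conv_in_prob_R_hat[OF S k] g])
  show "(\<lambda>\<omega>. g (R_hat X n (k n) S \<omega>)) \<in> borel_measurable M" for n
    by (rule measurable_compose[OF measurable_R_hat[OF S(1)]]) simp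
qed

end

section \<open>Radially decreasing densities\<close>

lemma nn_integral_affine:
  fixes f :: "'e::euclidean_space \<Rightarrow> ennreal"
  assumes [measurable]: "f \<in> borel_measurable borel" and c: "c \<noteq> 0"
  shows "(\<integral>\<^sup>+x. f x \<partial>lborel) = (\<integral>\<^sup>+x. ennreal (\<bar>c\<bar> ^ DIM('e)) * f (t + c *\<^sub>R x) \<partial>lborel)"
  by (subst lborel_affine[OF c, of t]) (simp add: nn_integral_density nn_integral_distr)

lemma null_sets_hyperplane:
  fixes e :: "'e::euclidean_space"
  assumes "e \<noteq> 0"
  shows "{u. u \<bullet> e = c} \<in> null_sets lborel"
proof -
  have "negligible {u. e \<bullet> u = c}"
    using assms by (intro negligible_hyperplane) auto
  then have "{u. u \<bullet> e = c} \<in> null_sets (completion lborel)"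
    by (simp add: negligible_iff_null_sets inner_commute)
  moreover have "{u. u \<bullet> e = c} \<in> sets lborel"
    by measurable
  ultimately show ?thesis by (simp add: null_sets_completion_iff)
qed

text \<open>Of rotation invariance, \<open>law\<close> keeps only what is used: a common law of the
  projections onto unit vectors. This covers the reflection of the line and the rotations of the
  plane alike.\<close>

locale radial_density =
  fixes \<phi>0 :: "'e::euclidean_space \<Rightarrow> real" and \<nu> :: "real measure"
  assumes meas [measurable]: "\<phi>0 \<in> borel_measurable borel"
    and pos: "\<phi>0 u > 0"
    and decreasing: "norm u \<le> norm v \<Longrightarrow> \<phi>0 v \<le> \<phi>0 u"
    and total: "(\<integral>\<^sup>+u. ennreal (\<phi>0 u) \<partial>lborel) = 1"
    and law: "norm e = 1 \<Longrightarrow> distr (density lborel (\<lambda>u. ennreal (\<phi>0 u))) borel (\<lambda>u. u \<bullet> e) = \<nu>"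
begin

abbreviation \<mu> :: "'e measure" where
  "\<mu> \<equiv> density lborel (\<lambda>u. ennreal (\<phi>0 u))"

sublocale \<mu>: prob_space \<mu>
  by (rule prob_spaceI) (simp add: emeasure_density total)

lemma measure_\<nu>:
  assumes "norm e = 1" "A \<in> sets borel"
  shows "measure \<nu> A = measure \<mu> {u. u \<bullet> e \<in> A}"
  using assms by (simp add: law[OF assms(1), symmetric] measure_distr vimage_def)

lemma ex_unit_vector: obtains e :: 'e where "norm e = 1"
  using nonempty_Basis norm_Basis by blast

sublocale \<nu>: real_distribution \<nu>
proof -
  obtain e :: 'e where "norm e = 1" by (rule ex_unit_vector)
  then show "real_distribution \<nu>"
    using \<mu>.real_distribution_distr[of "\<lambda>u. u \<bullet> e"] law by simp
qed

text \<open>A projection takes the value \<open>c\<close> on a hyperplane, which is a Lebesgue null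
  set.\<close>

lemma \<nu>_singleton: "measure \<nu> {c} = 0"
proof -
  obtain e :: 'e where e: "norm e = 1" by (rule ex_unit_vector)
  then have "{u. u \<bullet> e = c} \<in> null_sets lborel"
    by (intro null_sets_hyperplane) auto
  then have "AE u in lborel. u \<notin> {u. u \<bullet> e = c}"
    by (rule AE_not_in)
  then have "{u. u \<bullet> e = c} \<in> null_sets \<mu>"
    by (subst null_sets_density_iff) (auto elim: eventually_mono)
  then show ?thesis
    using measure_\<nu>[OF e, of "{c}"] by (simp add: measure_eq_0_null_sets)
qed

lemma isCont_cdf_\<nu>: "isCont (cdf \<nu>) x"
  by (simp add: \<nu>.isCont_cdf \<nu>_singleton)

text \<open>The mass between \<open>x\<close> and \<open>y\<close> is that of a strip. It contains a
  nonempty open set, on which the density is positive, so it cannot vanish.\<close>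

lemma cdf_\<nu>_strict_mono:
  assumes "x < y"
  shows "cdf \<nu> x < cdf \<nu> y"
proof -
  obtain e :: 'e where e: "norm e = 1" by (rule ex_unit_vector)
  let ?A = "{u. u \<bullet> e \<in> {x<..y}}"
  have "measure \<mu> ?A \<noteq> 0"
  proof
    assume "measure \<mu> ?A = 0"
    then have "?A \<in> null_sets \<mu>"
      by (simp add: null_sets_def \<mu>.emeasure_eq_measure)
    then have "AE u in lborel. u \<in> ?A \<longrightarrow> ennreal (\<phi>0 u) = 0"
      by (subst (asm) null_sets_density_iff) auto
    then have "AE u in lborel. u \<notin> ?A"
      using pos by (auto elim!: eventually_mono simp: ennreal_eq_0_iff not_le[symmetric])
    then have "?A \<in> null_sets lborel"
      by (subst AE_iff_null_sets) auto
    then have "negligible ?A"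
      by (simp add: negligible_iff_null_sets null_sets_completionI)
    then have "negligible {u. u \<bullet> e \<in> {x<..<y}}"
      by (rule negligible_subset) auto
    moreover have "open {u. u \<bullet> e \<in> {x<..<y}}"
      by (intro open_Collect_conj open_Collect_less continuous_intros | simp)+
    moreover have "((x + y) / 2) *\<^sub>R e \<in> {u. u \<bullet> e \<in> {x<..<y}}"
      using e assms by (simp add: dot_square_norm)
    ultimately show False
      using open_not_negligible by blast
  qed
  then have "measure \<nu> {x<..y} > 0"
    using measure_\<nu>[OF e, of "{x<..y}"] by (simp add: zero_less_measure_iff)
  then show ?thesis
    using \<nu>.cdf_diff_eq[OF assms] by simp
qed

lemma inj_cdf_\<nu>: "inj (cdf \<nu>)"
  by (metis cdf_\<nu>_strict_mono injI less_irrefl linorder_neqE)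

text \<open>Closed and open half-spaces are both needed, so that two opposite ones can partition the
  space.\<close>

lemma measure_half_space:
  assumes "norm e = 1"
  shows "measure \<mu> {u. c \<le> u \<bullet> e} = 1 - cdf \<nu> c" and "measure \<mu> {u. c < u \<bullet> e} = 1 - cdf \<nu> c"
proof -
  have "measure \<nu> {c<..} = 1 - cdf \<nu> c"
    using \<nu>.prob_compl[of "{..c}"] by (simp add: cdf_def Compl_eq_Diff_UNIV[symmetric])
  then show "measure \<mu> {u. c < u \<bullet> e} = 1 - cdf \<nu> c"
    using measure_\<nu>[OF assms, of "{c<..}"] by simp
  have "measure \<nu> {c..} = measure \<nu> ({c} \<union> {c<..})"
    by (intro arg_cong[where f = "measure \<nu>"]) auto
  also have "\<dots> = measure \<nu> {c} + measure \<nu> {c<..}"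
    by (intro \<nu>.finite_measure_Union) auto
  finally show "measure \<mu> {u. c \<le> u \<bullet> e} = 1 - cdf \<nu> c"
    using \<open>measure \<nu> {c<..} = 1 - cdf \<nu> c\<close> measure_\<nu>[OF assms, of "{c..}"] by (simp add: \<nu>_singleton)
qed

text \<open>The substitution \<open>u = \<beta> (x - t)\<close>, whose Jacobian is the factor
  \<open>\<beta> ^ DIM('e)\<close>.\<close>

lemma
  fixes t :: 'e
  assumes \<beta>: "\<beta> > 0" and [measurable]: "A \<in> sets borel"
  defines "f \<equiv> \<lambda>x. \<beta> ^ DIM('e) * \<phi>0 (\<beta> *\<^sub>R (x - t)) * indicator A (\<beta> *\<^sub>R (x - t))"
  shows integral_rescaled: "(\<integral>x. f x \<partial>lborel) = measure \<mu> A"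
    and integrable_rescaled: "integrable lborel f"
proof -
  have [measurable]: "f \<in> borel_measurable borel" unfolding f_def by measurable
  have f_nonneg: "f x \<ge> 0" for x
    using \<beta> pos[of "\<beta> *\<^sub>R (x - t)"] by (simp add: f_def)
  have "ennreal (measure \<mu> A) = emeasure \<mu> A"
    by (simp add: \<mu>.emeasure_eq_measure)
  also have "\<dots> = (\<integral>\<^sup>+u. ennreal (\<phi>0 u) * indicator A u \<partial>lborel)"
    by (rule emeasure_density) auto
  also have "\<dots> = (\<integral>\<^sup>+x. ennreal (f x) \<partial>lborel)"
    using \<beta> by (subst nn_integral_affine[of _ \<beta> "- (\<beta> *\<^sub>R t)"])
      (auto intro!: nn_integral_cong simp: f_def ennreal_mult' indicator_def algebra_simps
        pos[THEN less_imp_le])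
  finally have eq: "(\<integral>\<^sup>+x. ennreal (f x) \<partial>lborel) = ennreal (measure \<mu> A)" ..
  show "integrable lborel f"
    using eq f_nonneg by (intro integrableI_nonneg) auto
  show "(\<integral>x. f x \<partial>lborel) = measure \<mu> A"
    using eq f_nonneg by (subst integral_eq_nn_integral) auto
qed

text \<open>The bisecting hyperplane of \<open>s\<close> and \<open>t\<close> separates the regions where either of the two shifted
  densities is the smaller one.\<close>

lemma integral_min_shifts:
  assumes \<beta>: "\<beta> > 0" and st: "s \<noteq> t"
  shows "(\<integral>x. min (\<beta> ^ DIM('e) * \<phi>0 (\<beta> *\<^sub>R (x - s))) (\<beta> ^ DIM('e) * \<phi>0 (\<beta> *\<^sub>R (x - t))) \<partial>lborel)
    = 2 * (1 - cdf \<nu> (\<beta> * norm (s - t) / 2))"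
proof -
  define h where "h = norm (t - s)"
  define e where "e = (1 / h) *\<^sub>R (t - s)"
  define c where "c = \<beta> * h / 2"
  have h: "h > 0" using st by (simp add: h_def)
  have e: "norm e = 1" "norm (- e) = 1"
    using h by (simp_all add: e_def h_def)
  have ts: "t = s + h *\<^sub>R e" using h by (simp add: e_def)
  have ee: "e \<bullet> e = 1" using e(1) by (simp add: dot_square_norm)
  \<comment> \<open>The closed half-space is seen from \<open>s\<close>, the open one from
    \<open>t\<close> in direction \<open>- e\<close>; in the coordinate \<open>x\<close> they
    partition the space along the bisecting hyperplane.\<close>
  let ?f = "\<lambda>A t x. \<beta> ^ DIM('e) * \<phi>0 (\<beta> *\<^sub>R (x - t)) * indicator A (\<beta> *\<^sub>R (x - t))"
  have [measurable]: "{u. c \<le> u \<bullet> e} \<in> sets borel" "{u. c < u \<bullet> (- e)} \<in> sets borel"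
    by measurable
  have "min (\<beta> ^ DIM('e) * \<phi>0 (\<beta> *\<^sub>R (x - s))) (\<beta> ^ DIM('e) * \<phi>0 (\<beta> *\<^sub>R (x - t)))
      = ?f {u. c \<le> u \<bullet> e} s x + ?f {u. c < u \<bullet> (- e)} t x" for x
  proof -
    \<comment> \<open>The sign of \<open>h * (2 * ((x - s) \<bullet> e) - h)\<close> tells which
      site is closer, and the density shifted to the farther site is the smaller one.\<close>
    have *: "(norm (x - s))\<^sup>2 = (norm (x - t))\<^sup>2 + (2 * h * ((x - s) \<bullet> e) - h\<^sup>2)"
      unfolding ts power2_norm_eq_inner
      by (simp add: ee inner_simps inner_commute power2_eq_square algebra_simps)
    have te: "(x - t) \<bullet> e = (x - s) \<bullet> e - h"
      unfolding ts by (simp add: ee inner_simps)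
    have c_le: "c \<le> (\<beta> *\<^sub>R (x - s)) \<bullet> e \<longleftrightarrow> \<beta> * (h / 2) \<le> \<beta> * ((x - s) \<bullet> e)"
      unfolding inner_scaleR_left c_def by simp
    have eq: "(\<beta> *\<^sub>R (x - t)) \<bullet> (- e) = \<beta> * h - \<beta> * ((x - s) \<bullet> e)"
      unfolding inner_scaleR_left inner_minus_right te by (simp add: right_diff_distrib)
    have c_less: "c < (\<beta> *\<^sub>R (x - t)) \<bullet> (- e) \<longleftrightarrow> \<beta> * ((x - s) \<bullet> e) < \<beta> * (h / 2)"
      unfolding c_def eq by linarith
    show ?thesis
    proof (cases "h / 2 \<le> (x - s) \<bullet> e")
      case True
      then have "h * (2 * ((x - s) \<bullet> e) - h) \<ge> 0" using h by (intro mult_nonneg_nonneg) auto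
      then have "(norm (x - t))\<^sup>2 \<le> (norm (x - s))\<^sup>2"
        unfolding * by (simp add: power2_eq_square algebra_simps)
      then have "norm (\<beta> *\<^sub>R (x - t)) \<le> norm (\<beta> *\<^sub>R (x - s))"
        using \<beta> by (simp add: power_mono_iff)
      then have "\<beta> ^ DIM('e) * \<phi>0 (\<beta> *\<^sub>R (x - s)) \<le> \<beta> ^ DIM('e) * \<phi>0 (\<beta> *\<^sub>R (x - t))"
        using \<beta> by (intro mult_left_mono decreasing) auto
      moreover have "c \<le> (\<beta> *\<^sub>R (x - s)) \<bullet> e" "\<not> c < (\<beta> *\<^sub>R (x - t)) \<bullet> (- e)"
        unfolding c_le c_less using True \<beta> by (simp_all only: mult_le_cancel_left_pos mult_less_cancel_left_pos not_less)
      ultimately show ?thesis by (simp add: indicator_def)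
    next
      case False
      then have "h * (2 * ((x - s) \<bullet> e) - h) \<le> 0" using h by (intro mult_nonneg_nonpos) auto
      then have "(norm (x - s))\<^sup>2 \<le> (norm (x - t))\<^sup>2"
        unfolding * by (simp add: power2_eq_square algebra_simps)
      then have "norm (\<beta> *\<^sub>R (x - s)) \<le> norm (\<beta> *\<^sub>R (x - t))"
        using \<beta> by (simp add: power_mono_iff)
      then have "\<beta> ^ DIM('e) * \<phi>0 (\<beta> *\<^sub>R (x - t)) \<le> \<beta> ^ DIM('e) * \<phi>0 (\<beta> *\<^sub>R (x - s))"
        using \<beta> by (intro mult_left_mono decreasing) auto
      moreover have "\<not> c \<le> (\<beta> *\<^sub>R (x - s)) \<bullet> e" "c < (\<beta> *\<^sub>R (x - t)) \<bullet> (- e)"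
        unfolding c_le c_less using False \<beta> by (simp_all only: mult_le_cancel_left_pos mult_less_cancel_left_pos not_le)
      ultimately show ?thesis by (simp add: indicator_def)
    qed
  qed
  moreover have "(\<integral>x. ?f {u. c \<le> u \<bullet> e} s x + ?f {u. c < u \<bullet> (- e)} t x \<partial>lborel)
      = (\<integral>x. ?f {u. c \<le> u \<bullet> e} s x \<partial>lborel) + (\<integral>x. ?f {u. c < u \<bullet> (- e)} t x \<partial>lborel)"
    using \<beta> by (intro Bochner_Integration.integral_add integrable_rescaled) measurable
  then have "(\<integral>x. ?f {u. c \<le> u \<bullet> e} s x + ?f {u. c < u \<bullet> (- e)} t x \<partial>lborel)
      = measure \<mu> {u. c \<le> u \<bullet> e} + measure \<mu> {u. c < u \<bullet> (- e)}"
    by (simp only: integral_rescaled[OF \<beta> \<open>{u. c \<le> u \<bullet> e} \<in> sets borel\<close>]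
      integral_rescaled[OF \<beta> \<open>{u. c < u \<bullet> (- e)} \<in> sets borel\<close>])
  ultimately show ?thesis
    unfolding measure_half_space(1)[OF e(1)] measure_half_space(2)[OF e(2)]
    by (simp add: c_def h_def norm_minus_commute)
qed

end

section \<open>Rotation invariance of Lebesgue measure in the plane\<close>

lemma measurable_fst_borel_plane [measurable]: "fst \<in> borel_measurable (borel :: (real \<times> real) measure)"
  by (intro borel_measurable_continuous_onI continuous_intros)

lemma measurable_snd_borel_plane [measurable]: "snd \<in> borel_measurable (borel :: (real \<times> real) measure)"
  by (intro borel_measurable_continuous_onI continuous_intros)

text \<open>By Fubini a shear acts as a translation on each horizontal line.\<close>

lemma nn_integral_shear_fst:
  fixes f :: "real \<times> real \<Rightarrow> ennreal"
  assumes [measurable]: "f \<in> borel_measurable borel"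
  shows "(\<integral>\<^sup>+u. f (fst u + p * snd u, snd u) \<partial>lborel) = (\<integral>\<^sup>+u. f u \<partial>lborel)"
proof -
  have "(\<integral>\<^sup>+u. f (fst u + p * snd u, snd u) \<partial>lborel) =
      (\<integral>\<^sup>+u. f (fst u + p * snd u, snd u) \<partial>(lborel \<Otimes>\<^sub>M lborel))"
    by (simp add: lborel_prod)
  also have "\<dots> = (\<integral>\<^sup>+y. \<integral>\<^sup>+x. f (x + p * y, y) \<partial>lborel \<partial>lborel)"
    by (subst lborel_pair.nn_integral_snd[symmetric]) simp_all
  also have "\<dots> = (\<integral>\<^sup>+y. \<integral>\<^sup>+x. f (x, y) \<partial>lborel \<partial>lborel)"
  proof (rule nn_integral_cong)
    fix y :: real
    show "(\<integral>\<^sup>+x. f (x + p * y, y) \<partial>lborel) = (\<integral>\<^sup>+x. f (x, y) \<partial>lborel)"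
      by (subst nn_integral_real_affine[of "\<lambda>x. f (x, y)" 1 "p * y"]) (simp_all add: add.commute)
  qed
  also have "\<dots> = (\<integral>\<^sup>+u. f u \<partial>(lborel \<Otimes>\<^sub>M lborel))"
    by (rule lborel_pair.nn_integral_snd) (simp add: lborel_prod)
  finally show ?thesis by (simp add: lborel_prod)
qed

lemma nn_integral_shear_snd:
  fixes f :: "real \<times> real \<Rightarrow> ennreal"
  assumes [measurable]: "f \<in> borel_measurable borel"
  shows "(\<integral>\<^sup>+u. f (fst u, snd u + q * fst u) \<partial>lborel) = (\<integral>\<^sup>+u. f u \<partial>lborel)"
proof -
  have "(\<integral>\<^sup>+u. f (fst u, snd u + q * fst u) \<partial>lborel) =
      (\<integral>\<^sup>+u. f (fst u, snd u + q * fst u) \<partial>(lborel \<Otimes>\<^sub>M lborel))"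
    by (simp add: lborel_prod)
  also have "\<dots> = (\<integral>\<^sup>+x. \<integral>\<^sup>+y. f (x, y + q * x) \<partial>lborel \<partial>lborel)"
    by (subst lborel.nn_integral_fst[symmetric]) simp_all
  also have "\<dots> = (\<integral>\<^sup>+x. \<integral>\<^sup>+y. f (x, y) \<partial>lborel \<partial>lborel)"
  proof (rule nn_integral_cong)
    fix x :: real
    show "(\<integral>\<^sup>+y. f (x, y + q * x) \<partial>lborel) = (\<integral>\<^sup>+y. f (x, y) \<partial>lborel)"
      by (subst nn_integral_real_affine[of "\<lambda>y. f (x, y)" 1 "q * x"]) (simp_all add: add.commute)
  qed
  also have "\<dots> = (\<integral>\<^sup>+u. f u \<partial>(lborel \<Otimes>\<^sub>M lborel))"
    by (rule lborel.nn_integral_fst) (simp add: lborel_prod)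
  finally show ?thesis by (simp add: lborel_prod)
qed

text \<open>A rotation by an angle other than a half turn is a composition of three shears.\<close>

lemma nn_integral_rotation:
  fixes f :: "real \<times> real \<Rightarrow> ennreal"
  assumes [measurable]: "f \<in> borel_measurable borel" and cs: "c\<^sup>2 + s\<^sup>2 = 1"
  shows "(\<integral>\<^sup>+u. f (c * fst u + s * snd u, c * snd u - s * fst u) \<partial>lborel) = (\<integral>\<^sup>+u. f u \<partial>lborel)"
proof (cases "c = - 1")
  \<comment> \<open>The half turn is the point reflection; it is separated because the coefficient
    \<open>p\<close> used otherwise has the denominator \<open>1 + c\<close>.\<close>
  case True
  then have "s = 0" using cs by simp
  have "(\<integral>\<^sup>+u. f u \<partial>lborel) = (\<integral>\<^sup>+u. ennreal (\<bar>- 1\<bar> ^ DIM(real \<times> real)) * f (0 + (- 1) *\<^sub>R u) \<partial>lborel)"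
    by (rule nn_integral_affine) simp_all
  also have "\<dots> = (\<integral>\<^sup>+u. f (c * fst u + s * snd u, c * snd u - s * fst u) \<partial>lborel)"
    using True \<open>s = 0\<close> by (intro nn_integral_cong) (simp add: prod_eq_iff uminus_prod_def)
  finally show ?thesis by simp
next
  case False
  \<comment> \<open>For an angle with cosine \<open>c\<close> and sine \<open>s\<close> this is the
    tangent of half the angle; the three shears have coefficients \<open>p\<close>,
    \<open>- s\<close> and \<open>p\<close>.\<close>
  define p where "p = s / (1 + c)"
  have c1: "1 + c \<noteq> 0" using False by auto
  have "s * s = (1 - c) * (1 + c)"
    using cs by (simp add: power2_eq_square algebra_simps)
  then have ps: "p * s = 1 - c"
    using c1 by (simp add: p_def)
  have pc: "p * (1 + c) = s"
    using c1 by (simp add: p_def)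
  have m1 [measurable]: "(\<lambda>u. f (fst u + p * snd u, snd u)) \<in> borel_measurable borel"
    by (rule measurable_compose[OF _ assms(1)]) (intro borel_measurable_continuous_onI continuous_intros)
  have m2 [measurable]: "(\<lambda>u. f (fst u + p * (snd u + - s * fst u), snd u + - s * fst u)) \<in> borel_measurable borel"
    by (rule measurable_compose[OF _ assms(1)]) (intro borel_measurable_continuous_onI continuous_intros)
  have "(\<integral>\<^sup>+u. f u \<partial>lborel) = (\<integral>\<^sup>+u. f (fst u + p * snd u, snd u) \<partial>lborel)"
    by (rule nn_integral_shear_fst[symmetric]) simp
  also have "\<dots> = (\<integral>\<^sup>+u. f (fst u + p * (snd u + - s * fst u), snd u + - s * fst u) \<partial>lborel)"
    by (subst nn_integral_shear_snd[OF m1, of "- s", symmetric]) simp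
  also have "\<dots> = (\<integral>\<^sup>+u. f (fst u + p * snd u + p * (snd u + - s * (fst u + p * snd u)), snd u + - s * (fst u + p * snd u)) \<partial>lborel)"
    by (subst nn_integral_shear_fst[OF m2, of p, symmetric]) simp
  also have "\<dots> = (\<integral>\<^sup>+u. f (c * fst u + s * snd u, c * snd u - s * fst u) \<partial>lborel)"
  proof (rule nn_integral_cong)
    fix u :: "real \<times> real"
    have 1: "snd u + - s * (fst u + p * snd u) = c * snd u - s * fst u"
    proof -
      have "snd u + - s * (fst u + p * snd u) = snd u - s * fst u - (p * s) * snd u"
        by (simp add: algebra_simps)
      then show ?thesis unfolding ps by (simp add: algebra_simps)
    qed
    have "fst u + p * snd u + p * (c * snd u - s * fst u) = fst u - (p * s) * fst u + (p * (1 + c)) * snd u"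
      by (simp add: algebra_simps)
    also have "\<dots> = c * fst u + s * snd u"
      unfolding ps pc by (simp add: algebra_simps)
    finally have 2: "fst u + p * snd u + p * (c * snd u - s * fst u) = c * fst u + s * snd u" .
    show "f (fst u + p * snd u + p * (snd u + - s * (fst u + p * snd u)), snd u + - s * (fst u + p * snd u))
        = f (c * fst u + s * snd u, c * snd u - s * fst u)"
      unfolding 1 2 ..
  qed
  finally show ?thesis ..
qed

section \<open>Radial densities on the line and in the plane\<close>

lemma radial_density_line:
  fixes \<phi>0 :: "real \<Rightarrow> real"
  assumes [measurable]: "\<phi>0 \<in> borel_measurable borel" and "\<And>u. \<phi>0 u > 0"
    and dec: "\<And>u v. norm u \<le> norm v \<Longrightarrow> \<phi>0 v \<le> \<phi>0 u"
    and "(\<integral>\<^sup>+u. ennreal (\<phi>0 u) \<partial>lborel) = 1"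
  shows "radial_density \<phi>0 (density lborel (\<lambda>u. ennreal (\<phi>0 u)))"
proof
  fix e :: real assume "norm e = 1"
  then consider "e = 1" | "e = - 1" by (auto simp: abs_if split: if_splits)
  then show "distr (density lborel (\<lambda>u. ennreal (\<phi>0 u))) borel (\<lambda>u. u \<bullet> e) = density lborel (\<lambda>u. ennreal (\<phi>0 u))"
  proof cases
    case 1
    have "distr (density lborel (\<lambda>u. ennreal (\<phi>0 u))) borel (\<lambda>u. u) = density lborel (\<lambda>u. ennreal (\<phi>0 u))"
      by (rule distr_id2) simp
    then show ?thesis using 1 by simp
  next
    case 2
    \<comment> \<open>Monotonicity in the norm, used in both directions, yields symmetry.\<close>
    have even: "\<phi>0 (- x) = \<phi>0 x" for x
      by (intro antisym dec) auto
    show ?thesis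
    proof (rule measure_eqI)
      fix A assume "A \<in> sets (distr (density lborel (\<lambda>u. ennreal (\<phi>0 u))) borel (\<lambda>u. u \<bullet> e))"
      then have [measurable]: "A \<in> sets borel" by simp
      have "emeasure (distr (density lborel (\<lambda>u. ennreal (\<phi>0 u))) borel (\<lambda>u. u \<bullet> e)) A
          = (\<integral>\<^sup>+x. ennreal (\<phi>0 x) * indicator A (- x) \<partial>lborel)"
        using 2 by (simp add: emeasure_distr emeasure_density vimage_def indicator_def cong: if_cong)
      also have "\<dots> = (\<integral>\<^sup>+x. ennreal (\<phi>0 x) * indicator A x \<partial>lborel)"
        by (subst nn_integral_real_affine[of _ "- 1" 0]) (simp_all add: even)
      finally show "emeasure (distr (density lborel (\<lambda>u. ennreal (\<phi>0 u))) borel (\<lambda>u. u \<bullet> e)) A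
          = emeasure (density lborel (\<lambda>u. ennreal (\<phi>0 u))) A"
        by (simp add: emeasure_density)
    qed simp
  qed
qed fact+

text \<open>The rotation sending \<open>e\<close> to the first basis vector preserves Lebesgue
  measure and the density, and turns the projection onto \<open>e\<close> into the first
  coordinate.\<close>

lemma radial_density_plane:
  fixes \<phi>0 :: "real \<times> real \<Rightarrow> real"
  assumes [measurable]: "\<phi>0 \<in> borel_measurable borel" and "\<And>u. \<phi>0 u > 0"
    and dec: "\<And>u v. norm u \<le> norm v \<Longrightarrow> \<phi>0 v \<le> \<phi>0 u"
    and "(\<integral>\<^sup>+u. ennreal (\<phi>0 u) \<partial>lborel) = 1"
  shows "radial_density \<phi>0 (distr (density lborel (\<lambda>u. ennreal (\<phi>0 u))) borel fst)"
proof
  fix e :: "real \<times> real" assume e: "norm e = 1"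
  obtain c s where cs: "e = (c, s)" by (cases e)
  have cs1: "c\<^sup>2 + s\<^sup>2 = 1" using e by (simp add: cs norm_prod_def)
  have radial: "\<phi>0 u = \<phi>0 v" if "norm u = norm v" for u v
    using that by (intro antisym dec) auto
  show "distr (density lborel (\<lambda>u. ennreal (\<phi>0 u))) borel (\<lambda>u. u \<bullet> e) = distr (density lborel (\<lambda>u. ennreal (\<phi>0 u))) borel fst"
  proof (rule measure_eqI)
    fix A assume "A \<in> sets (distr (density lborel (\<lambda>u. ennreal (\<phi>0 u))) borel (\<lambda>u. u \<bullet> e))"
    then have A [measurable]: "A \<in> sets borel" by simp
    have m [measurable]: "(\<lambda>u. ennreal (\<phi>0 u) * indicator A (fst u)) \<in> borel_measurable borel"
      using measurable_compose[OF measurable_fst_borel_plane borel_measurable_indicator[OF A]]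
      by (intro borel_measurable_times_ennreal) auto
    have "emeasure (distr (density lborel (\<lambda>u. ennreal (\<phi>0 u))) borel fst) A
        = (\<integral>\<^sup>+u. ennreal (\<phi>0 u) * indicator A (fst u) \<partial>lborel)"
      by (subst emeasure_distr, simp_all add: measurable_fst_borel_plane, subst emeasure_density)
         (simp_all add: measurable_fst_borel_plane measurable_sets_borel[OF measurable_fst_borel_plane] indicator_def)
    also have "\<dots> = (\<integral>\<^sup>+u. ennreal (\<phi>0 (c * fst u + s * snd u, c * snd u - s * fst u)) *
        indicator A (c * fst u + s * snd u) \<partial>lborel)"
      by (subst nn_integral_rotation[OF m cs1, symmetric]) simp
    also have "\<dots> = (\<integral>\<^sup>+u. ennreal (\<phi>0 u) * indicator A (u \<bullet> e) \<partial>lborel)"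
    proof (intro nn_integral_cong)
      fix u :: "real \<times> real"
      have "(c * fst u + s * snd u)\<^sup>2 + (c * snd u - s * fst u)\<^sup>2 = (c\<^sup>2 + s\<^sup>2) * ((fst u)\<^sup>2 + (snd u)\<^sup>2)"
        by (simp add: power2_eq_square algebra_simps)
      then have "norm (c * fst u + s * snd u, c * snd u - s * fst u) = norm u"
        by (simp add: cs1 norm_prod_def)
      then have "\<phi>0 (c * fst u + s * snd u, c * snd u - s * fst u) = \<phi>0 u"
        by (rule radial)
      moreover have "c * fst u + s * snd u = u \<bullet> e"
        by (simp add: cs inner_prod_def mult.commute)
      ultimately show "ennreal (\<phi>0 (c * fst u + s * snd u, c * snd u - s * fst u)) * indicator A (c * fst u + s * snd u)
          = ennreal (\<phi>0 u) * indicator A (u \<bullet> e)" by simp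
    qed
    also have "\<dots> = emeasure (distr (density lborel (\<lambda>u. ennreal (\<phi>0 u))) borel (\<lambda>u. u \<bullet> e)) A"
      by (simp add: emeasure_distr emeasure_density vimage_def indicator_def cong: if_cong)
    finally show "emeasure (distr (density lborel (\<lambda>u. ennreal (\<phi>0 u))) borel (\<lambda>u. u \<bullet> e)) A
        = emeasure (distr (density lborel (\<lambda>u. ennreal (\<phi>0 u))) borel fst) A" ..
  qed simp
qed fact+

section \<open>The exponential model in the plane\<close>

lemma nn_integral_exp_tails:
  shows "(\<integral>\<^sup>+y. ennreal (exp (c - y)) * indicator {a..} y \<partial>lborel) = ennreal (exp (c - a))"
    and "(\<integral>\<^sup>+y. ennreal (exp (c + y)) * indicator {..a} y \<partial>lborel) = ennreal (exp (c + a))"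
proof -
  have upper: "(\<integral>\<^sup>+y. ennreal (exp (c - y)) * indicator {a..} y \<partial>lborel) = ennreal (exp (c - a))" for a c :: real
  proof -
    have "(\<integral>\<^sup>+y. ennreal (exp (c - y)) * indicator {a..} y \<partial>lborel) = ennreal (0 - (- exp (c - a)))"
    proof (rule nn_integral_FTC_atLeast)
      show "((\<lambda>y. - exp (c - y)) \<longlongrightarrow> 0) at_top"
      proof -
        have "((\<lambda>y. - (exp c * exp (- y))) \<longlongrightarrow> - (exp c * 0)) at_top"
          by (intro tendsto_intros filterlim_compose[OF exp_at_bot] filterlim_uminus_at_bot_at_top)
        then show ?thesis by (simp add: exp_diff exp_minus divide_inverse)
      qed
      show "((\<lambda>y. - exp (c - y)) has_real_derivative exp (c - y)) (at y)" for y
        by (auto intro!: derivative_eq_intros)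
    qed auto
    then show ?thesis by simp
  qed
  show "(\<integral>\<^sup>+y. ennreal (exp (c - y)) * indicator {a..} y \<partial>lborel) = ennreal (exp (c - a))"
    by (rule upper)
  have "(\<integral>\<^sup>+y. ennreal (exp (c + y)) * indicator {..a} y \<partial>lborel)
      = (\<integral>\<^sup>+y. ennreal (exp (c - y)) * indicator {- a..} y \<partial>lborel)"
    by (subst nn_integral_real_affine[of _ "- 1" 0]) (auto intro!: nn_integral_cong simp: indicator_def)
  then show "(\<integral>\<^sup>+y. ennreal (exp (c + y)) * indicator {..a} y \<partial>lborel) = ennreal (exp (c + a))"
    by (simp add: upper)
qed

text \<open>The two exponents cross exactly once, at \<open>(B + q - p) / 2\<close>, because \<open>\<bar>p - q\<bar> \<le> B\<close>.\<close>

lemma nn_integral_exp_max_nonneg: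
  fixes p q B :: real
  assumes "\<bar>p - q\<bar> \<le> B"
  shows "(\<integral>\<^sup>+y. ennreal (exp (- max (p + \<bar>y\<bar>) (q + \<bar>y - B\<bar>))) \<partial>lborel) = ennreal (2 * exp (- (p + q + B) / 2))"
proof -
  \<comment> \<open>The hypothesis gives \<open>0 \<le> z\<close> and \<open>z \<le> B\<close>.
    Hence \<open>\<bar>y - B\<bar> = B - y\<close> to the left of \<open>z\<close> and
    \<open>\<bar>y\<bar> = y\<close> to the right, where the respective branch dominates.\<close>
  define z where "z = (B + q - p) / 2"
  have "(\<integral>\<^sup>+y. ennreal (exp (- max (p + \<bar>y\<bar>) (q + \<bar>y - B\<bar>))) \<partial>lborel) =
      (\<integral>\<^sup>+y. ennreal (exp (- (q + B) + y)) * indicator {..z} y + ennreal (exp (- p - y)) * indicator {z..} y \<partial>lborel)"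
  proof (rule nn_integral_cong_AE)
    show "AE y in lborel. ennreal (exp (- max (p + \<bar>y\<bar>) (q + \<bar>y - B\<bar>))) =
        ennreal (exp (- (q + B) + y)) * indicator {..z} y + ennreal (exp (- p - y)) * indicator {z..} y"
      using AE_lborel_singleton[of z]
    proof eventually_elim
      case (elim y)
      consider "y < z" | "z < y" using elim by linarith
      then show ?case
      proof cases
        case 1
        then have "max (p + \<bar>y\<bar>) (q + \<bar>y - B\<bar>) = q + B - y"
          using assms by (auto simp: z_def max_def abs_if field_simps split: if_splits)
        then show ?thesis using 1 by (simp add: algebra_simps)
      next
        case 2
        then have "max (p + \<bar>y\<bar>) (q + \<bar>y - B\<bar>) = p + y"
          using assms by (auto simp: z_def max_def abs_if field_simps split: if_splits)
        then show ?thesis using 2 by (simp add: algebra_simps)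
      qed
    qed
  qed
  also have "\<dots> = ennreal (exp (- (q + B) + z)) + ennreal (exp (- p - z))"
    by (subst nn_integral_add, measurable) (simp only: nn_integral_exp_tails)
  also have "\<dots> = ennreal (exp (- (q + B) + z) + exp (- p - z))"
    by simp
  also have "- (q + B) + z = - (p + q + B) / 2"
    by (simp add: z_def field_simps)
  also have "- p - z = - (p + q + B) / 2"
    by (simp add: z_def field_simps)
  finally show ?thesis by (simp only: mult_2)
qed

lemma nn_integral_exp_max:
  fixes p q B :: real
  assumes "\<bar>p - q\<bar> \<le> \<bar>B\<bar>"
  shows "(\<integral>\<^sup>+y. ennreal (exp (- max (p + \<bar>y\<bar>) (q + \<bar>y - B\<bar>))) \<partial>lborel) = ennreal (2 * exp (- (p + q + \<bar>B\<bar>) / 2))"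
proof (cases "B \<ge> 0")
  case True
  then show ?thesis using nn_integral_exp_max_nonneg[of p q B] assms by simp
next
  case False
  have "(\<integral>\<^sup>+y. ennreal (exp (- max (p + \<bar>y\<bar>) (q + \<bar>y - B\<bar>))) \<partial>lborel) =
      (\<integral>\<^sup>+y. ennreal (exp (- max (p + \<bar>y\<bar>) (q + \<bar>y - (- B)\<bar>))) \<partial>lborel)"
    by (subst nn_integral_real_affine[of _ "- 1" 0])
       (auto intro!: nn_integral_cong arg_cong[where f = exp] simp: abs_if)
  then show ?thesis using nn_integral_exp_max_nonneg[of p q "- B"] assms False by simp
qed

text \<open>Between 0 and \<open>A\<close> the exponent is constant, which contributes
  \<open>A\<close>; each tail contributes 1; all carry the factor \<open>exp (- A / 2)\<close>. This
  is the source of the linear factor inverted in \<open>Q\<close>.\<close>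

lemma nn_integral_exp_sum_nonneg:
  fixes A :: real
  assumes "0 \<le> A"
  shows "(\<integral>\<^sup>+x. ennreal (exp (- (\<bar>x\<bar> + \<bar>x - A\<bar>) / 2)) \<partial>lborel) = ennreal ((2 + A) * exp (- A / 2))"
proof -
  have "(\<integral>\<^sup>+x. ennreal (exp (- (\<bar>x\<bar> + \<bar>x - A\<bar>) / 2)) \<partial>lborel) =
      (\<integral>\<^sup>+x. ennreal (exp (- A / 2 + x)) * indicator {..0} x + ennreal (exp (- A / 2)) * indicator {0..A} x
        + ennreal (exp (A / 2 - x)) * indicator {A..} x \<partial>lborel)"
  proof (rule nn_integral_cong_AE)
    show "AE x in lborel. ennreal (exp (- (\<bar>x\<bar> + \<bar>x - A\<bar>) / 2)) =
        ennreal (exp (- A / 2 + x)) * indicator {..0} x + ennreal (exp (- A / 2)) * indicator {0..A} x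
        + ennreal (exp (A / 2 - x)) * indicator {A..} x"
      using AE_lborel_singleton[of 0] AE_lborel_singleton[of A]
    proof eventually_elim
      case (elim x)
      consider "x < 0" | "0 < x" "x < A" | "A < x" using elim by linarith
      then show ?case
        using assms by cases (auto simp: abs_if field_simps)
    qed
  qed
  also have "\<dots> = ennreal (exp (- A / 2 + 0)) + ennreal (exp (- A / 2)) * ennreal A + ennreal (exp (A / 2 - A))"
    using assms by (subst nn_integral_add, measurable, subst nn_integral_add, measurable)
      (simp only: nn_integral_exp_tails nn_integral_cmult_indicator sets_lborel atLeastAtMost_borel
        emeasure_lborel_Icc diff_zero)
  also have "\<dots> = ennreal ((2 + A) * exp (- A / 2))"
    using assms by (simp add: ennreal_mult'[symmetric] ennreal_plus[symmetric] algebra_simps del: ennreal_plus)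
  finally show ?thesis .
qed

lemma nn_integral_exp_sum:
  fixes A :: real
  shows "(\<integral>\<^sup>+x. ennreal (exp (- (\<bar>x\<bar> + \<bar>x - A\<bar>) / 2)) \<partial>lborel) = ennreal ((2 + \<bar>A\<bar>) * exp (- \<bar>A\<bar> / 2))"
proof (cases "A \<ge> 0")
  case True
  then show ?thesis using nn_integral_exp_sum_nonneg[of A] by simp
next
  case False
  have "(\<integral>\<^sup>+x. ennreal (exp (- (\<bar>x\<bar> + \<bar>x - A\<bar>) / 2)) \<partial>lborel) =
      (\<integral>\<^sup>+x. ennreal (exp (- (\<bar>x\<bar> + \<bar>x - (- A)\<bar>) / 2)) \<partial>lborel)"
    by (subst nn_integral_real_affine[of _ "- 1" 0])
       (auto intro!: nn_integral_cong arg_cong[where f = exp] simp: abs_if)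
  then show ?thesis using nn_integral_exp_sum_nonneg[of "- A"] False by simp
qed

text \<open>Integrating first along the coordinate with the larger displacement meets the crossing
  condition for every \<open>x\<close>, since \<open>\<bar>x\<bar>\<close> and
  \<open>\<bar>x - A\<bar>\<close> differ by at most \<open>\<bar>A\<bar>\<close>. The smaller
  displacement thus ends up in the linear factor.\<close>

lemma nn_integral_iterated_exp_max:
  fixes A B :: real
  assumes "\<bar>A\<bar> \<le> \<bar>B\<bar>"
  shows "(\<integral>\<^sup>+x. \<integral>\<^sup>+y. ennreal (exp (- max (\<bar>x\<bar> + \<bar>y\<bar>) (\<bar>x - A\<bar> + \<bar>y - B\<bar>))) \<partial>lborel \<partial>lborel)
    = ennreal (4 * ((1 + \<bar>A\<bar> / 2) * exp (- (\<bar>A\<bar> + \<bar>B\<bar>) / 2)))"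
proof -
  have "(\<integral>\<^sup>+y. ennreal (exp (- max (\<bar>x\<bar> + \<bar>y\<bar>) (\<bar>x - A\<bar> + \<bar>y - B\<bar>))) \<partial>lborel)
      = ennreal (2 * exp (- \<bar>B\<bar> / 2)) * ennreal (exp (- (\<bar>x\<bar> + \<bar>x - A\<bar>) / 2))" for x
    using assms by (subst nn_integral_exp_max)
      (auto simp: ennreal_mult'[symmetric] exp_add[symmetric] field_simps)
  then have "(\<integral>\<^sup>+x. \<integral>\<^sup>+y. ennreal (exp (- max (\<bar>x\<bar> + \<bar>y\<bar>) (\<bar>x - A\<bar> + \<bar>y - B\<bar>))) \<partial>lborel \<partial>lborel)
      = ennreal (2 * exp (- \<bar>B\<bar> / 2)) * ennreal ((2 + \<bar>A\<bar>) * exp (- \<bar>A\<bar> / 2))"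
    by (simp only:) (subst nn_integral_cmult, measurable, simp only: nn_integral_exp_sum)
  also have "\<dots> = ennreal (4 * ((1 + \<bar>A\<bar> / 2) * exp (- (\<bar>A\<bar> + \<bar>B\<bar>) / 2)))"
  proof -
    have "exp (- (\<bar>A\<bar> + \<bar>B\<bar>) / 2) = exp (- \<bar>A\<bar> / 2) * exp (- \<bar>B\<bar> / 2)"
      by (simp add: exp_add[symmetric] field_simps)
    then have "2 * exp (- \<bar>B\<bar> / 2) * ((2 + \<bar>A\<bar>) * exp (- \<bar>A\<bar> / 2))
        = 4 * ((1 + \<bar>A\<bar> / 2) * exp (- (\<bar>A\<bar> + \<bar>B\<bar>) / 2))"
      by (simp only:) (simp add: algebra_simps)
    then show ?thesis
      by (subst ennreal_mult'[symmetric]) (simp_all only: exp_ge_zero mult_nonneg_nonneg zero_le_numeral)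
  qed
  finally show ?thesis .
qed

lemma integral_min_exponential_plane:
  fixes s t :: "real \<times> real"
  assumes \<beta>: "\<beta> > 0"
  defines "a \<equiv> \<bar>fst s - fst t\<bar>" and "b \<equiv> \<bar>snd s - snd t\<bar>"
  shows "(\<integral>x. min (\<beta>\<^sup>2 * \<phi>0_plane Exponential (\<beta> *\<^sub>R (x - s))) (\<beta>\<^sup>2 * \<phi>0_plane Exponential (\<beta> *\<^sub>R (x - t))) \<partial>lborel)
    = (1 + \<beta> / 2 * min a b) * exp (- \<beta> / 2 * (a + b))"
proof -
  \<comment> \<open>\<open>A\<close> and \<open>B\<close> are the displacements of the second site
    in the coordinates \<open>u = \<beta> (x - s)\<close>, in which \<open>f\<close> is the minimum
    of the two densities.\<close>
  define A where "A = \<beta> * (fst t - fst s)"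
  define B where "B = \<beta> * (snd t - snd s)"
  define f where "f u = exp (- max (\<bar>fst u\<bar> + \<bar>snd u\<bar>) (\<bar>fst u - A\<bar> + \<bar>snd u - B\<bar>)) / 4" for u :: "real \<times> real"
  have [measurable]: "f \<in> borel_measurable borel" unfolding f_def[abs_def] by measurable
  have f0: "f u \<ge> 0" for u by (simp add: f_def)
  have f_eq: "f u = min (exp (- \<bar>fst u\<bar> - \<bar>snd u\<bar>) / 4) (exp (- \<bar>fst u - A\<bar> - \<bar>snd u - B\<bar>) / 4)" for u
    by (auto simp: f_def max_def min_def)
  have A': "\<bar>A\<bar> = \<beta> * a" "\<bar>B\<bar> = \<beta> * b"
    using \<beta> by (simp_all add: A_def B_def a_def b_def abs_mult abs_minus_commute)
  have total: "(\<integral>\<^sup>+u. ennreal (f u) \<partial>lborel) = ennreal ((1 + \<beta> / 2 * min a b) * exp (- \<beta> / 2 * (a + b)))"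
  proof -
    have "(\<integral>\<^sup>+u. ennreal (f u) \<partial>lborel) = (\<integral>\<^sup>+u. ennreal (1 / 4) * ennreal (4 * f u) \<partial>lborel)"
      using f0 by (intro nn_integral_cong) (simp add: ennreal_mult'[symmetric])
    also have "\<dots> = ennreal (1 / 4) * (\<integral>\<^sup>+u. ennreal (4 * f u) \<partial>(lborel \<Otimes>\<^sub>M lborel))"
      by (simp add: nn_integral_cmult lborel_prod)
    also have "(\<integral>\<^sup>+u. ennreal (4 * f u) \<partial>(lborel \<Otimes>\<^sub>M lborel))
      = ennreal (4 * ((1 + min \<bar>A\<bar> \<bar>B\<bar> / 2) * exp (- (\<bar>A\<bar> + \<bar>B\<bar>) / 2)))"
    proof (cases "\<bar>A\<bar> \<le> \<bar>B\<bar>")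
      case True
      have "(\<integral>\<^sup>+u. ennreal (4 * f u) \<partial>(lborel \<Otimes>\<^sub>M lborel)) = (\<integral>\<^sup>+x. \<integral>\<^sup>+y. ennreal (4 * f (x, y)) \<partial>lborel \<partial>lborel)"
        by (rule lborel.nn_integral_fst[symmetric]) (simp add: lborel_prod)
      then show ?thesis
        using nn_integral_iterated_exp_max[OF True] True by (simp add: f_def min_def)
    next
      \<comment> \<open>Now the first coordinate has the larger displacement, so it becomes the
        inner variable.\<close>
      case False
      have "(\<integral>\<^sup>+u. ennreal (4 * f u) \<partial>(lborel \<Otimes>\<^sub>M lborel)) = (\<integral>\<^sup>+y. \<integral>\<^sup>+x. ennreal (4 * f (x, y)) \<partial>lborel \<partial>lborel)"
        by (rule lborel_pair.nn_integral_snd[symmetric]) (simp add: lborel_prod)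
      then show ?thesis
        using nn_integral_iterated_exp_max[of B A] False by (simp add: f_def min_def add.commute)
    qed
    also have "ennreal (1 / 4) * \<dots> = ennreal ((1 + min \<bar>A\<bar> \<bar>B\<bar> / 2) * exp (- (\<bar>A\<bar> + \<bar>B\<bar>) / 2))"
      by (subst ennreal_mult'[symmetric]) simp_all
    also have "(1 + min \<bar>A\<bar> \<bar>B\<bar> / 2) * exp (- (\<bar>A\<bar> + \<bar>B\<bar>) / 2) = (1 + \<beta> / 2 * min a b) * exp (- \<beta> / 2 * (a + b))"
    proof -
      have "min (\<beta> * a) (\<beta> * b) = \<beta> * min a b"
        using \<beta> by (simp add: min_mult_distrib_left)
      moreover have "- (\<beta> * a + \<beta> * b) / 2 = - \<beta> / 2 * (a + b)"
        by (simp add: field_simps)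
      ultimately show ?thesis unfolding A' by simp
    qed
    finally show ?thesis .
  qed
  have min_eq: "min (\<beta>\<^sup>2 * \<phi>0_plane Exponential (\<beta> *\<^sub>R (x - s))) (\<beta>\<^sup>2 * \<phi>0_plane Exponential (\<beta> *\<^sub>R (x - t)))
      = \<beta>\<^sup>2 * f (\<beta> *\<^sub>R (x - s))" for x
  proof -
    have "fst (\<beta> *\<^sub>R (x - s)) - A = fst (\<beta> *\<^sub>R (x - t))" "snd (\<beta> *\<^sub>R (x - s)) - B = snd (\<beta> *\<^sub>R (x - t))"
      by (simp_all add: A_def B_def algebra_simps)
    then show ?thesis
      unfolding f_eq by (simp only: \<phi>0_plane.simps) (simp add: min_mult_distrib_left)
  qed
  have "(\<integral>\<^sup>+x. ennreal (\<beta>\<^sup>2 * f (\<beta> *\<^sub>R (x - s))) \<partial>lborel) = (\<integral>\<^sup>+u. ennreal (f u) \<partial>lborel)"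
  proof -
    have "\<bar>\<beta>\<bar> ^ DIM(real \<times> real) = \<beta>\<^sup>2" by (simp add: power2_eq_square)
    moreover have "- (\<beta> *\<^sub>R s) + \<beta> *\<^sub>R x = \<beta> *\<^sub>R (x - s)" for x
      by (simp add: scaleR_diff_right)
    ultimately show ?thesis
      using \<beta> nn_integral_affine[of "\<lambda>u. ennreal (f u)" \<beta> "- (\<beta> *\<^sub>R s)"]
      by (simp only: ennreal_mult'[OF zero_le_power2]) simp
  qed
  then have "(\<integral>\<^sup>+x. ennreal (\<beta>\<^sup>2 * f (\<beta> *\<^sub>R (x - s))) \<partial>lborel)
      = ennreal ((1 + \<beta> / 2 * min a b) * exp (- \<beta> / 2 * (a + b)))"
    by (simp only: total)
  moreover have "a \<ge> 0" "b \<ge> 0" by (simp_all add: a_def b_def)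
  ultimately show ?thesis
    unfolding min_eq using \<beta> f0 by (subst integral_eq_nn_integral) simp_all
qed

section \<open>Consistency of the estimators\<close>

lemma \<phi>0_line_pos: "(\<And>\<nu>. mdl = Student_t \<nu> \<Longrightarrow> \<nu> \<ge> 1) \<Longrightarrow> \<phi>0_line mdl x > 0"
proof (cases mdl)
  case (Student_t \<nu>)
  assume "\<And>\<nu>. mdl = Student_t \<nu> \<Longrightarrow> \<nu> \<ge> 1"
  then have "\<nu> \<ge> 1" using Student_t by blast
  then have "1 + x\<^sup>2 / real \<nu> > 0" by (intro add_pos_nonneg) auto
  then show ?thesis
    using Student_t \<open>\<nu> \<ge> 1\<close> by (auto intro!: mult_pos_pos divide_pos_pos Gamma_real_pos)
qed auto

lemma \<phi>0_line_decreasing: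
  assumes \<nu>: "\<And>\<nu>. mdl = Student_t \<nu> \<Longrightarrow> \<nu> \<ge> 1" and uv: "norm u \<le> norm v"
  shows "\<phi>0_line mdl v \<le> \<phi>0_line mdl u"
proof -
  have sq: "u\<^sup>2 \<le> v\<^sup>2" using uv by (simp add: abs_le_square_iff)
  show ?thesis
  proof (cases mdl)
    case Exponential
    then show ?thesis using uv by simp
  next
    case Normal
    then show ?thesis using sq by (simp add: divide_right_mono)
  next
    case (Student_t \<nu>)
    have "\<nu> \<ge> 1" using \<nu>[OF Student_t] .
    have "(1 + v\<^sup>2 / real \<nu>) powr (- (real \<nu> + 1) / 2) \<le> (1 + u\<^sup>2 / real \<nu>) powr (- (real \<nu> + 1) / 2)"
      using sq \<open>\<nu> \<ge> 1\<close> by (intro powr_mono2') (auto intro!: add_pos_nonneg divide_right_mono)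
    moreover have "Gamma ((real \<nu> + 1) / 2) / (sqrt (pi * real \<nu>) * Gamma (real \<nu> / 2)) \<ge> 0"
      using \<open>\<nu> \<ge> 1\<close> by (intro divide_nonneg_nonneg mult_nonneg_nonneg less_imp_le[OF Gamma_real_pos]) auto
    ultimately show ?thesis
      unfolding Student_t \<phi>0_line.simps by (rule mult_left_mono)
  qed
qed

lemma measurable_\<phi>0_line: "\<phi>0_line mdl \<in> borel_measurable borel"
proof (cases mdl)
  case Exponential
  have "(\<lambda>x::real. exp (- \<bar>x\<bar>) / 2) \<in> borel_measurable borel" by measurable
  then show ?thesis by (simp add: Exponential cong: measurable_cong)
next
  case Normal
  have "(\<lambda>x::real. exp (- x\<^sup>2 / 2) / sqrt (2 * pi)) \<in> borel_measurable borel" by measurable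
  then show ?thesis by (simp add: Normal cong: measurable_cong)
next
  case (Student_t \<nu>)
  have "(\<lambda>x::real. Gamma ((real \<nu> + 1) / 2) / (sqrt (pi * real \<nu>) * Gamma (real \<nu> / 2)) *
     (1 + x\<^sup>2 / real \<nu>) powr (- (real \<nu> + 1) / 2)) \<in> borel_measurable borel" by measurable
  then show ?thesis by (simp add: Student_t cong: measurable_cong)
qed

lemma \<phi>0_plane_pos:
  assumes "mdl = Normal \<or> (\<exists>\<alpha>>1. mdl = Student_t \<alpha>)"
  shows "\<phi>0_plane mdl u > 0"
proof -
  have "1 + (norm u)\<^sup>2 / (2 * (\<alpha> - 1)) > 0" if "\<alpha> > 1" for \<alpha> :: real
    using that by (intro add_pos_nonneg) auto
  then show ?thesis using assms by fastforce
qed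

lemma \<phi>0_plane_decreasing:
  assumes "mdl = Normal \<or> (\<exists>\<alpha>>1. mdl = Student_t \<alpha>)" and uv: "norm u \<le> norm v"
  shows "\<phi>0_plane mdl v \<le> \<phi>0_plane mdl u"
proof -
  have sq: "(norm u)\<^sup>2 \<le> (norm v)\<^sup>2" using uv by (intro power_mono) auto
  have "(1 + (norm v)\<^sup>2 / (2 * (\<alpha> - 1))) powr (- \<alpha>) \<le> (1 + (norm u)\<^sup>2 / (2 * (\<alpha> - 1))) powr (- \<alpha>)" if "\<alpha> > 1" for \<alpha> :: real
    using that sq by (intro powr_mono2') (auto intro!: add_pos_nonneg divide_right_mono)
  then show ?thesis using assms(1) sq by (auto intro!: divide_right_mono)
qed

lemma measurable_\<phi>0_plane: "\<phi>0_plane mdl \<in> borel_measurable borel"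
proof (cases mdl)
  case Exponential
  have "(\<lambda>u::real \<times> real. exp (- \<bar>fst u\<bar> - \<bar>snd u\<bar>) / 4) \<in> borel_measurable borel"
    by (intro borel_measurable_continuous_onI continuous_intros) auto
  then show ?thesis by (simp add: Exponential cong: measurable_cong)
next
  case Normal
  have "(\<lambda>u::real \<times> real. exp (- (norm u)\<^sup>2 / 2) / (2 * pi)) \<in> borel_measurable borel" by measurable
  then show ?thesis by (simp add: Normal cong: measurable_cong)
next
  case (Student_t \<alpha>)
  have "(\<lambda>u::real \<times> real. (1 + (norm u)\<^sup>2 / (2 * (\<alpha> - 1))) powr (- \<alpha>) / (2 * pi)) \<in> borel_measurable borel" by measurable
  then show ?thesis by (simp add: Student_t cong: measurable_cong)
qed

text \<open>No Gaussian or Student integral has to be computed: the standardization of the margins forces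
  the generating density to have total mass one.\<close>

lemma (in max_attraction) nn_integral_eq_1:
  assumes \<phi>: "\<phi> = (\<lambda>x. \<beta> ^ DIM('e) * \<phi>0 (\<beta> *\<^sub>R x))" and \<beta>: "\<beta> > 0"
    and [measurable]: "\<phi>0 \<in> borel_measurable borel" and nonneg: "\<And>u. \<phi>0 u \<ge> 0"
  shows "(\<integral>\<^sup>+u. ennreal (\<phi>0 u) \<partial>lborel) = 1"
proof -
  have "(\<integral>\<^sup>+u. ennreal (\<phi>0 u) \<partial>lborel) = (\<integral>\<^sup>+x. ennreal (\<phi> (x - 0)) \<partial>lborel)"
    using \<beta> nonneg by (subst nn_integral_affine[of _ \<beta> 0]) (auto simp: \<phi> ennreal_mult' intro!: nn_integral_cong)
  also have "\<dots> = ennreal (\<integral>x. \<phi> (x - 0) \<partial>lborel)"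
    using \<beta> nonneg by (intro nn_integral_eq_integral integrable_\<phi>_shift) (auto simp: \<phi>)
  finally show ?thesis by (simp only: integral_\<phi>_shift ennreal_1)
qed

lemma sum_pairs_const: "(\<Sum>m=1..d. \<Sum>j=1..<m. y) = real d * (real d - 1) / 2 * y"
proof (induction d)
  case (Suc d)
  have "(\<Sum>m=1..Suc d. \<Sum>j=1..<m. y) = (\<Sum>m=1..d. \<Sum>j=1..<m. y) + real d * y"
    by simp
  then show ?case unfolding Suc by (simp add: field_simps)
qed simp

text \<open>All pairs share one limit, and the prefactor is the reciprocal of the number of
  pairs.\<close>

lemma (in finite_measure) conv_in_prob_pair_average:
  assumes d: "d \<ge> 2"
    and conv: "\<And>j m. j \<in> {1..d} \<Longrightarrow> m \<in> {1..d} \<Longrightarrow> j < m \<Longrightarrow> conv_in_prob M (Y j m) y"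
  shows "conv_in_prob M (\<lambda>n \<omega>. 2 / (real d * (real d - 1)) * (\<Sum>m=1..d. \<Sum>j=1..<m. Y j m n \<omega>)) y"
proof -
  have "conv_in_prob M (\<lambda>n \<omega>. 2 / (real d * (real d - 1)) * (\<Sum>m=1..d. \<Sum>j=1..<m. Y j m n \<omega>))
      (2 / (real d * (real d - 1)) * (\<Sum>m=1..d. \<Sum>j=1..<m. y))"
    by (intro conv_in_prob_cmult conv_in_prob_sum conv) auto
  then show ?thesis
    unfolding sum_pairs_const using d by simp
qed

section \<open>Inverting the limit relations\<close>

context max_attraction begin

context
  fixes \<phi>0 :: "'e \<Rightarrow> real" and \<nu> :: "real measure" and \<beta> :: real and k :: "nat \<Rightarrow> nat"
  assumes radial: "radial_density \<phi>0 \<nu>" and \<beta>: "\<beta> > 0"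
    and \<phi>: "\<phi> = (\<lambda>x. \<beta> ^ DIM('e) * \<phi>0 (\<beta> *\<^sub>R x))"
    and k: "filterlim k at_top sequentially" "(\<lambda>n. real (k n) / real n) \<longlonglongrightarrow> 0"
begin

text \<open>The hypothesis \<open>Min\<close> admits more than pairs: any finite set of sites in
  which two fixed ones determine the minimum everywhere.\<close>

lemma conv_in_prob_inverse_cdf:
  assumes S: "finite S" "S \<noteq> {}" and st: "s \<noteq> t"
    and Min: "\<And>x. (MIN r\<in>S. \<phi> (x - r)) = min (\<phi> (x - s)) (\<phi> (x - t))"
  shows "conv_in_prob M (\<lambda>n \<omega>. inverse_fun UNIV (cdf \<nu>) c (1 - R_hat X n (k n) S \<omega> / 2)) (\<beta> * norm (s - t) / 2)"
proof -
  interpret radial_density \<phi>0 \<nu> by (rule radial)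
  let ?y = "\<beta> * norm (s - t) / 2" and ?g = "\<lambda>r. inverse_fun UNIV (cdf \<nu>) c (1 - r / 2)"
  let ?L = "\<integral>x. (MIN r\<in>S. \<phi> (x - r)) \<partial>lborel"
  have "?L = 2 * (1 - cdf \<nu> ?y)"
    unfolding Min unfolding \<phi> by (rule integral_min_shifts[OF \<beta> st])
  then have L: "1 - ?L / 2 = cdf \<nu> ?y" by (simp add: field_simps)
  note inv = isCont_inverse_fun[of UNIV "cdf \<nu>" ?y c]
  have "isCont ?g ?L"
  proof (rule isCont_o2[where f = "\<lambda>r. 1 - r / 2"])
    show "isCont (inverse_fun UNIV (cdf \<nu>) c) (1 - ?L / 2)"
      unfolding L by (rule inv) (auto simp: inj_cdf_\<nu> isCont_cdf_\<nu> intro: continuous_at_imp_continuous_on)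
  qed (intro continuous_intros; simp)
  then have "conv_in_prob M (\<lambda>n \<omega>. ?g (R_hat X n (k n) S \<omega>)) (?g ?L)"
    by (rule conv_in_prob_fun_R_hat[OF S k])
  moreover have "?g ?L = ?y"
    unfolding L by (rule inv) (auto simp: inj_cdf_\<nu> isCont_cdf_\<nu> intro: continuous_at_imp_continuous_on)
  ultimately show ?thesis by simp
qed

lemma conv_in_prob_\<beta>_pairs:
  assumes d: "d \<ge> 2" and t: "inj_on t {1..d}"
  shows "conv_in_prob M (\<lambda>n \<omega>. \<beta>_pairs (cdf \<nu>) c d t (\<lambda>S. R_hat X n (k n) S \<omega>)) \<beta>"
  unfolding \<beta>_pairs_def
proof (rule conv_in_prob_pair_average[OF d])
  fix j m assume jm: "j \<in> {1..d}" "m \<in> {1..d}" "j < m"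
  then have neq: "t j \<noteq> t m" using inj_onD[OF t, of j m] by auto
  have "conv_in_prob M (\<lambda>n \<omega>. 2 / norm (t j - t m) *
      inverse_fun UNIV (cdf \<nu>) c (1 - R_hat X n (k n) {t j, t m} \<omega> / 2))
      (2 / norm (t j - t m) * (\<beta> * norm (t j - t m) / 2))"
    by (intro conv_in_prob_cmult conv_in_prob_inverse_cdf neq) auto
  then show "conv_in_prob M (\<lambda>n \<omega>. 2 / norm (t j - t m) *
      inverse_fun UNIV (cdf \<nu>) c (1 - R_hat X n (k n) {t j, t m} \<omega> / 2)) \<beta>"
    using neq by simp
qed

end
end

text \<open>On the line the site farthest from a given point is always the smallest or the largest
  one, so the coefficient of all sites is that of the two extreme ones.\<close>

lemma conv_in_prob_\<beta>_range:
  fixes X :: "nat \<Rightarrow> 'w \<Rightarrow> real \<Rightarrow> real" and t :: "nat \<Rightarrow> real"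
  assumes "max_attraction M N X a b Zt \<gamma> \<phi>"
    and radial: "radial_density \<phi>0 \<nu>" and \<beta>: "\<beta> > 0" and \<phi>: "\<phi> = (\<lambda>x. \<beta> ^ DIM(real) * \<phi>0 (\<beta> *\<^sub>R x))"
    and k: "filterlim k at_top sequentially" "(\<lambda>n. real (k n) / real n) \<longlonglongrightarrow> 0"
    and d: "d \<ge> 2" and t: "inj_on t {1..d}"
  shows "conv_in_prob M (\<lambda>n \<omega>. \<beta>_range (cdf \<nu>) c d t (\<lambda>S. R_hat X n (k n) S \<omega>)) \<beta>"
proof -
  interpret max_attraction M N X a b Zt \<gamma> \<phi> by fact
  let ?S = "t ` {1..d}"
  define u where "u = (MAX j\<in>{1..d}. t j)"
  define l where "l = (MIN j\<in>{1..d}. t j)"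
  have S: "finite ?S" "?S \<noteq> {}" using d by auto
  have mem: "u \<in> ?S" "l \<in> ?S"
    unfolding u_def l_def using Max_in[OF S] Min_in[OF S] by auto
  have bounds: "l \<le> r" "r \<le> u" if "r \<in> ?S" for r
    unfolding u_def l_def using that S by auto
  have "t 1 \<noteq> t 2" using inj_onD[OF t, of 1 2] d by auto
  then have "l < u"
    using bounds[of "t 1"] bounds[of "t 2"] d by (cases "t 1" "t 2" rule: linorder_cases) auto
  have decreasing: "\<phi> v \<le> \<phi> w" if "\<bar>w\<bar> \<le> \<bar>v\<bar>" for v w
    unfolding \<phi> using \<beta> that
    by (intro mult_left_mono radial_density.decreasing[OF radial]) (auto simp: abs_mult)
  have Min: "(MIN r\<in>?S. \<phi> (x - r)) = min (\<phi> (x - u)) (\<phi> (x - l))" for x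
  proof (rule antisym)
    show "(MIN r\<in>?S. \<phi> (x - r)) \<le> min (\<phi> (x - u)) (\<phi> (x - l))"
      using mem S by (intro min.boundedI Min_le) auto
    have "min (\<phi> (x - u)) (\<phi> (x - l)) \<le> \<phi> (x - r)" if "r \<in> ?S" for r
    proof -
      have "\<bar>x - r\<bar> \<le> \<bar>x - u\<bar> \<or> \<bar>x - r\<bar> \<le> \<bar>x - l\<bar>"
        using bounds[OF that] by linarith
      then show ?thesis using decreasing by (auto simp: min_le_iff_disj)
    qed
    then show "min (\<phi> (x - u)) (\<phi> (x - l)) \<le> (MIN r\<in>?S. \<phi> (x - r))"
      using S by (subst Min_ge_iff) auto
  qed
  have "conv_in_prob M (\<lambda>n \<omega>. 2 / (u - l) * inverse_fun UNIV (cdf \<nu>) c (1 - R_hat X n (k n) ?S \<omega> / 2))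
      (2 / (u - l) * (\<beta> * norm (u - l) / 2))"
    using \<open>l < u\<close> by (intro conv_in_prob_cmult conv_in_prob_inverse_cdf[OF radial \<beta> \<phi> k S _ Min]) auto
  then show ?thesis
    unfolding \<beta>_range_def u_def[symmetric] l_def[symmetric] using \<open>l < u\<close> by simp
qed

text \<open>The derivative is negative because \<open>min a b < a + b\<close>. This remains true if
  one displacement vanishes, as for sites that share a coordinate.\<close>

lemma inj_on_exponential_coefficient:
  fixes a b :: real
  assumes "a \<ge> 0" "b \<ge> 0" "a + b > 0"
  shows "inj_on (\<lambda>\<beta>. (1 + \<beta> / 2 * min a b) * exp (- \<beta> / 2 * (a + b))) {0<..}"
proof (rule linorder_inj_onI)
  fix x y :: real assume xy: "x < y" "x \<in> {0<..}" "y \<in> {0<..}"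
  have "(1 + y / 2 * min a b) * exp (- y / 2 * (a + b)) < (1 + x / 2 * min a b) * exp (- x / 2 * (a + b))"
  proof (rule DERIV_neg_imp_decreasing[OF xy(1)])
    fix z assume z: "x \<le> z" "z \<le> y"
    have "min a b < a + b" using assms by (auto simp: min_def)
    moreover have "z * min a b * (a + b) \<ge> 0"
      using assms xy z by (intro mult_nonneg_nonneg) auto
    ultimately have neg: "(min a b / 2 - (1 + z / 2 * min a b) * ((a + b) / 2)) * exp (- z / 2 * (a + b)) < 0"
      by (intro mult_neg_pos) (auto simp: field_simps)
    have "((\<lambda>\<beta>. (1 + \<beta> / 2 * min a b) * exp (- \<beta> / 2 * (a + b))) has_real_derivative
        (min a b / 2 - (1 + z / 2 * min a b) * ((a + b) / 2)) * exp (- z / 2 * (a + b))) (at z)"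
      by (rule derivative_eq_intros refl | simp)+ (simp add: algebra_simps)
    with neg show "\<exists>D. ((\<lambda>\<beta>. (1 + \<beta> / 2 * min a b) * exp (- \<beta> / 2 * (a + b))) has_real_derivative D) (at z) \<and> D < 0"
      by blast
  qed
  then show "(1 + x / 2 * min a b) * exp (- x / 2 * (a + b)) \<noteq> (1 + y / 2 * min a b) * exp (- y / 2 * (a + b))"
    by simp
qed auto

lemma conv_in_prob_\<beta>_exp_plane:
  fixes X :: "nat \<Rightarrow> 'w \<Rightarrow> real \<times> real \<Rightarrow> real" and t :: "nat \<Rightarrow> real \<times> real"
  assumes "max_attraction M N X a b Zt \<gamma> (\<lambda>u. \<beta>\<^sup>2 * \<phi>0_plane Exponential (\<beta> *\<^sub>R u))"
    and \<beta>: "\<beta> > 0"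
    and k: "filterlim k at_top sequentially" "(\<lambda>n. real (k n) / real n) \<longlonglongrightarrow> 0"
    and d: "d \<ge> 2" and t: "inj_on t {1..d}"
  shows "conv_in_prob M (\<lambda>n \<omega>. \<beta>_exp_plane c d t (\<lambda>S. R_hat X n (k n) S \<omega>)) \<beta>"
  unfolding \<beta>_exp_plane_def
proof -
  interpret max_attraction M N X a b Zt \<gamma> "\<lambda>u. \<beta>\<^sup>2 * \<phi>0_plane Exponential (\<beta> *\<^sub>R u)" by fact
  show "conv_in_prob M (\<lambda>n \<omega>. 2 / (real d * (real d - 1)) * (\<Sum>m=1..d. \<Sum>j=1..<m.
      Q c \<bar>fst (t j) - fst (t m)\<bar> \<bar>snd (t j) - snd (t m)\<bar> (R_hat X n (k n) {t j, t m} \<omega>))) \<beta>"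
  proof (rule conv_in_prob_pair_average[OF d])
    fix j m assume jm: "j \<in> {1..d}" "m \<in> {1..d}" "j < m"
    define A where "A = \<bar>fst (t j) - fst (t m)\<bar>"
    define B where "B = \<bar>snd (t j) - snd (t m)\<bar>"
    have "t j \<noteq> t m" using inj_onD[OF t, of j m] jm by auto
    then have "A \<ge> 0" "B \<ge> 0" "A + B > 0"
      by (auto simp: A_def B_def prod_eq_iff)
    then have inj: "inj_on (\<lambda>\<beta>. (1 + \<beta> / 2 * min A B) * exp (- \<beta> / 2 * (A + B))) {0<..}"
      by (rule inj_on_exponential_coefficient)
    have cont: "continuous_on {0<..} (\<lambda>\<beta>. (1 + \<beta> / 2 * min A B) * exp (- \<beta> / 2 * (A + B)))"
      by (intro continuous_intros) auto
    let ?L = "\<integral>x. (MIN s\<in>{t j, t m}. \<beta>\<^sup>2 * \<phi>0_plane Exponential (\<beta> *\<^sub>R (x - s))) \<partial>lborel"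
    have L: "?L = (1 + \<beta> / 2 * min A B) * exp (- \<beta> / 2 * (A + B))"
      using integral_min_exponential_plane[OF \<beta>, of "t j" "t m"] by (simp add: A_def B_def del: \<phi>0_plane.simps)
    have inv: "isCont (Q c A B) ?L" "Q c A B ?L = \<beta>"
      unfolding L Q_def using isCont_inverse_fun[OF open_greaterThan inj cont, of \<beta> c] \<beta> by auto
    have "conv_in_prob M (\<lambda>n \<omega>. Q c A B (R_hat X n (k n) {t j, t m} \<omega>)) (Q c A B ?L)"
      by (rule conv_in_prob_fun_R_hat[OF _ _ k inv(1)]) auto
    then show "conv_in_prob M (\<lambda>n \<omega>. Q c \<bar>fst (t j) - fst (t m)\<bar> \<bar>snd (t j) - snd (t m)\<bar> (R_hat X n (k n) {t j, t m} \<omega>)) \<beta>"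
      unfolding A_def[symmetric] B_def[symmetric] inv(2) .
  qed
qed

theorem theorem3p1:
  fixes M :: "'w measure" and N :: "'v measure"
    and \<beta> c :: real and d :: nat and k :: "nat \<Rightarrow> nat"
  assumes "\<beta> > 0" and "d \<ge> 2"
    and "filterlim k at_top sequentially"
    and "(\<lambda>n. real (k n) / real n) \<longlonglongrightarrow> 0"
  shows
    "(\<forall>(X :: nat \<Rightarrow> 'w \<Rightarrow> real \<Rightarrow> real) a b Zt \<gamma> (mdl :: nat model) (t :: nat \<Rightarrow> real).
        (\<forall>\<nu>. mdl = Student_t \<nu> \<longrightarrow> \<nu> \<ge> 1) \<longrightarrow>
        max_attraction M N X a b Zt \<gamma> (\<lambda>x. \<beta> * \<phi>0_line mdl (\<beta> * x)) \<longrightarrow>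
        inj_on t {1..d} \<longrightarrow>
          conv_in_prob M
            (\<lambda>n \<omega>. \<beta>_range (F_line mdl) c d t (\<lambda>S. R_hat X n (k n) S \<omega>)) \<beta> \<and>
          conv_in_prob M
            (\<lambda>n \<omega>. \<beta>_pairs (F_line mdl) c d t (\<lambda>S. R_hat X n (k n) S \<omega>)) \<beta>)
     \<and> (\<forall>(X :: nat \<Rightarrow> 'w \<Rightarrow> real \<times> real \<Rightarrow> real) a b Zt \<gamma> (mdl :: real model)
          (t :: nat \<Rightarrow> real \<times> real).
        mdl = Normal \<or> (\<exists>\<alpha>>1. mdl = Student_t \<alpha>) \<longrightarrow>
        max_attraction M N X a b Zt \<gamma> (\<lambda>u. \<beta>\<^sup>2 * \<phi>0_plane mdl (\<beta> *\<^sub>R u)) \<longrightarrow>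
        inj_on t {1..d} \<longrightarrow>
          conv_in_prob M
            (\<lambda>n \<omega>. \<beta>_pairs (F_plane mdl) c d t (\<lambda>S. R_hat X n (k n) S \<omega>)) \<beta>)
     \<and> (\<forall>(X :: nat \<Rightarrow> 'w \<Rightarrow> real \<times> real \<Rightarrow> real) a b Zt \<gamma> (t :: nat \<Rightarrow> real \<times> real).
        max_attraction M N X a b Zt \<gamma> (\<lambda>u. \<beta>\<^sup>2 * \<phi>0_plane Exponential (\<beta> *\<^sub>R u)) \<longrightarrow>
        inj_on t {1..d} \<longrightarrow>
          conv_in_prob M
            (\<lambda>n \<omega>. \<beta>_exp_plane c d t (\<lambda>S. R_hat X n (k n) S \<omega>)) \<beta>)"
proof (intro conjI allI impI)
  note k = assms(3,4)
  fix X :: "nat \<Rightarrow> 'w \<Rightarrow> real \<Rightarrow> real" and a b Zt \<gamma> and mdl :: "nat model" and t :: "nat \<Rightarrow> real"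
  assume "\<forall>\<nu>. mdl = Student_t \<nu> \<longrightarrow> \<nu> \<ge> 1"
    and max: "max_attraction M N X a b Zt \<gamma> (\<lambda>x. \<beta> * \<phi>0_line mdl (\<beta> * x))" and t: "inj_on t {1..d}"
  then have mdl: "\<And>\<nu>. mdl = Student_t \<nu> \<Longrightarrow> \<nu> \<ge> 1" by blast
  interpret max_attraction M N X a b Zt \<gamma> "\<lambda>x. \<beta> * \<phi>0_line mdl (\<beta> * x)" by (rule max)
  have \<phi>: "(\<lambda>x. \<beta> * \<phi>0_line mdl (\<beta> * x)) = (\<lambda>x. \<beta> ^ DIM(real) * \<phi>0_line mdl (\<beta> *\<^sub>R x))"
    by simp
  have radial: "radial_density (\<phi>0_line mdl) (density lborel (\<lambda>x. ennreal (\<phi>0_line mdl x)))"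
    using \<phi>0_line_pos[OF mdl] \<phi>0_line_decreasing[OF mdl] \<open>\<beta> > 0\<close>
    by (intro radial_density_line nn_integral_eq_1[OF \<phi>] measurable_\<phi>0_line) (auto intro: less_imp_le)
  show "conv_in_prob M (\<lambda>n \<omega>. \<beta>_range (F_line mdl) c d t (\<lambda>S. R_hat X n (k n) S \<omega>)) \<beta>"
    unfolding F_line_def by (rule conv_in_prob_\<beta>_range[OF max radial \<open>\<beta> > 0\<close> \<phi> k \<open>d \<ge> 2\<close> t])
  show "conv_in_prob M (\<lambda>n \<omega>. \<beta>_pairs (F_line mdl) c d t (\<lambda>S. R_hat X n (k n) S \<omega>)) \<beta>"
    unfolding F_line_def by (rule conv_in_prob_\<beta>_pairs[OF radial \<open>\<beta> > 0\<close> \<phi> k \<open>d \<ge> 2\<close> t])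
next
  note k = assms(3,4)
  fix X :: "nat \<Rightarrow> 'w \<Rightarrow> real \<times> real \<Rightarrow> real" and a b Zt \<gamma> and mdl :: "real model"
    and t :: "nat \<Rightarrow> real \<times> real"
  assume mdl: "mdl = Normal \<or> (\<exists>\<alpha>>1. mdl = Student_t \<alpha>)"
    and max: "max_attraction M N X a b Zt \<gamma> (\<lambda>u. \<beta>\<^sup>2 * \<phi>0_plane mdl (\<beta> *\<^sub>R u))" and t: "inj_on t {1..d}"
  interpret max_attraction M N X a b Zt \<gamma> "\<lambda>u. \<beta>\<^sup>2 * \<phi>0_plane mdl (\<beta> *\<^sub>R u)" by (rule max)
  have \<phi>: "(\<lambda>u. \<beta>\<^sup>2 * \<phi>0_plane mdl (\<beta> *\<^sub>R u)) = (\<lambda>u. \<beta> ^ DIM(real \<times> real) * \<phi>0_plane mdl (\<beta> *\<^sub>R u))"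
    by (simp add: power2_eq_square)
  have radial: "radial_density (\<phi>0_plane mdl) (distr (density lborel (\<lambda>u. ennreal (\<phi>0_plane mdl u))) borel fst)"
    using \<phi>0_plane_pos[OF mdl] \<phi>0_plane_decreasing[OF mdl] \<open>\<beta> > 0\<close>
    by (intro radial_density_plane nn_integral_eq_1[OF \<phi>] measurable_\<phi>0_plane) (auto intro: less_imp_le)
  show "conv_in_prob M (\<lambda>n \<omega>. \<beta>_pairs (F_plane mdl) c d t (\<lambda>S. R_hat X n (k n) S \<omega>)) \<beta>"
    unfolding F_plane_def by (rule conv_in_prob_\<beta>_pairs[OF radial \<open>\<beta> > 0\<close> \<phi> k \<open>d \<ge> 2\<close> t])
next
  fix X :: "nat \<Rightarrow> 'w \<Rightarrow> real \<times> real \<Rightarrow> real" and a b Zt \<gamma> and t :: "nat \<Rightarrow> real \<times> real"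
  assume "max_attraction M N X a b Zt \<gamma> (\<lambda>u. \<beta>\<^sup>2 * \<phi>0_plane Exponential (\<beta> *\<^sub>R u))" "inj_on t {1..d}"
  then show "conv_in_prob M (\<lambda>n \<omega>. \<beta>_exp_plane c d t (\<lambda>S. R_hat X n (k n) S \<omega>)) \<beta>"
    using assms by (intro conv_in_prob_\<beta>_exp_plane)
qed

end
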